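(* Let $G$ be a graph with $n$ nodes, an unknown girth $g < \log n$, and minimum degree $\delta \geq 2$. Assume that for a given integer parameter $a > 0$, every node $v$ knows the edges of $N_a(v)$, and that $N_a(v)$ is a tree. There exists an algorithm which completes in $O(1)$ rounds of the Congested Clique model and either reports $g$ exactly, or reaches one of the following two states: (1) every node $v$ knows $N_{2a}(v)$; or (2) for some value $b \geq \lceil g/2 \rceil - 1$ which is agreed upon by all nodes of the network, every node $v$ knows all of $N_b(v)$. All nodes know whether $g$ was reported exactly, and if not, which state was reached.
   Context: The girth is the length of a shortest cycle. For a node $v$ and integer $i$, $N_i(v)$ denotes the graph consisting of all nodes at hop-distance at most $i$ from $v$ together with all edges incident to nodes at hop-distance at most $i-1$ from $v$. Congested Clique model: the $n$ vertices of $G$ are synchronous processors; in each round every pair may exchange an $O(\log n)$-bit message; initially each node knows its incident edges. *)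

theory Defs
  imports Complex_Main "HOL-Library.Extended_Nat"
begin

section \<open>Finite simple graphs\<close>

record 'v ugraph =
  verts :: "'v set"
  edges :: "'v set set"

definition simple_graph :: "'v ugraph \<Rightarrow> bool" where
  "simple_graph G \<longleftrightarrow> finite (verts G) \<and> (\<forall>e\<in>edges G. e \<subseteq> verts G \<and> card e = 2)"

definition incident_edges :: "'v ugraph \<Rightarrow> 'v \<Rightarrow> 'v set set" where
  "incident_edges G v = {e \<in> edges G. v \<in> e}"

definition degree :: "'v ugraph \<Rightarrow> 'v \<Rightarrow> nat" where
  "degree G v = card (incident_edges G v)"

definition is_walk :: "'v ugraph \<Rightarrow> 'v list \<Rightarrow> bool" where
  "is_walk G p \<longleftrightarrow>
     p \<noteq> [] \<and> set p \<subseteq> verts G \<and> successively (\<lambda>x y. {x, y} \<in> edges G) p"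

text \<open>The infimum is \<open>\<infinity>\<close> if there is no walk from \<open>u\<close> to \<open>v\<close>.\<close>

definition hop_dist :: "'v ugraph \<Rightarrow> 'v \<Rightarrow> 'v \<Rightarrow> enat" where
  "hop_dist G u v = (INF p \<in> {p. is_walk G p \<and> hd p = u \<and> last p = v}. enat (length p - 1))"

text \<open>A cycle is given by its vertices in cyclic order, so its length is the length of the list.\<close>

definition is_cycle :: "'v ugraph \<Rightarrow> 'v list \<Rightarrow> bool" where
  "is_cycle G p \<longleftrightarrow>
     3 \<le> length p \<and> distinct p \<and> is_walk G p \<and> {last p, hd p} \<in> edges G"

definition girth :: "'v ugraph \<Rightarrow> enat" where
  "girth G = (INF p \<in> {p. is_cycle G p}. enat (length p))"

definition is_tree :: "'v ugraph \<Rightarrow> bool" where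
  "is_tree G \<longleftrightarrow>
     verts G \<noteq> {} \<and>
     (\<forall>u\<in>verts G. \<forall>v\<in>verts G. \<exists>p. is_walk G p \<and> hd p = u \<and> last p = v) \<and>
     (\<nexists>p. is_cycle G p)"

text \<open>
  The graph \<open>N\<^sub>i(v)\<close>. The bound ``at most \<open>i - 1\<close>'' on the distance is written as ``less
  than \<open>i\<close>'', so that \<open>N\<^sub>0(v)\<close> has no edges. An edge between two vertices at distance
  exactly \<open>i\<close> does not belong to \<open>N\<^sub>i(v)\<close>.
\<close>

definition nbhd :: "'v ugraph \<Rightarrow> nat \<Rightarrow> 'v \<Rightarrow> 'v ugraph" where
  "nbhd G i v =
     \<lparr>verts = {u \<in> verts G. hop_dist G v u \<le> enat i},
      edges = {e \<in> edges G. \<exists>u\<in>e. hop_dist G v u < enat i}\<rparr>"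


section \<open>The Congested Clique\<close>

text \<open>
  The processors are \<open>0, \<dots>, n - 1\<close>. Initially a processor knows \<open>n\<close>, its own identifier, its
  incident edges, and problem-specific prior knowledge of type \<open>'k\<close>.
\<close>

record 'k cc_input =
  num_nodes :: nat
  ident :: nat
  incident :: "nat set set"
  prior :: 'k

definition cc_initial :: "nat ugraph \<Rightarrow> (nat \<Rightarrow> 'k) \<Rightarrow> nat \<Rightarrow> 'k cc_input" where
  "cc_initial G K v =
     \<lparr>num_nodes = card (verts G), ident = v, incident = incident_edges G v, prior = K v\<rparr>"

text \<open>
  A history lists, round by round, the bit string received from each processor. Local
  computation is deterministic and unbounded, so the state of a processor may be taken to be its
  initial input together with its history: the messages it sends in the next round (one for each
  recipient) and its output are functions of these two. The current round number is the length
  of the history.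
\<close>

type_synonym history = "(nat \<Rightarrow> bool list) list"

record ('k, 'o) cc_algorithm =
  send :: "'k cc_input \<Rightarrow> history \<Rightarrow> nat \<Rightarrow> bool list"
  result :: "'k cc_input \<Rightarrow> history \<Rightarrow> 'o"

primrec cc_history ::
  "('k, 'o) cc_algorithm \<Rightarrow> nat \<Rightarrow> (nat \<Rightarrow> 'k cc_input) \<Rightarrow> nat \<Rightarrow> nat \<Rightarrow> history" where
  "cc_history A n I 0 v = []"
| "cc_history A n I (Suc r) v =
     cc_history A n I r v @
     [\<lambda>u. if u < n \<and> u \<noteq> v then send A (I u) (cc_history A n I r u) v else []]"

definition cc_bandwidth ::
  "('k, 'o) cc_algorithm \<Rightarrow> nat \<Rightarrow> (nat \<Rightarrow> 'k cc_input) \<Rightarrow> nat \<Rightarrow> real \<Rightarrow> bool" where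
  "cc_bandwidth A n I R B \<longleftrightarrow>
     (\<forall>r<R. \<forall>u<n. \<forall>v<n. u \<noteq> v \<longrightarrow>
        real (length (send A (I u) (cc_history A n I r u) v)) \<le> B)"

definition cc_output ::
  "('k, 'o) cc_algorithm \<Rightarrow> nat \<Rightarrow> (nat \<Rightarrow> 'k cc_input) \<Rightarrow> nat \<Rightarrow> nat \<Rightarrow> 'o" where
  "cc_output A n I R v = result A (I v) (cc_history A n I R v)"


section \<open>Neighborhood doubling\<close>

text \<open>Every node knows the parameter \<open>a\<close> and the edges of \<open>N\<^sub>a(v)\<close>.\<close>

definition nbhd_knowledge :: "nat ugraph \<Rightarrow> nat \<Rightarrow> nat \<Rightarrow> nat \<times> nat set set" where
  "nbhd_knowledge G a v = (a, edges (nbhd G a v))"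

text \<open>
  The local output of a node. To know a graph at the end is to output it, and to know which
  case occurred is to output the corresponding constructor.
\<close>

datatype outcome =
    Girth_Reported nat
  | Doubled "nat ugraph"
  | Radius_Reached nat "nat ugraph"

end

theory Submission
  imports Defs "HOL-Library.Log_Nat"
begin

text \<open>
  The edges of \<open>N\<^sub>r(v)\<close> are the last edges of the non-backtracking walks of length at most \<open>r\<close> from
  \<open>v\<close>, and walks of total length less than \<open>g\<close> with the same ends coincide. A walk of length \<open>a + j\<close>
  from \<open>v\<close> is a walk of length \<open>a\<close> to some \<open>u\<close>, known to \<open>v\<close>, followed by a walk of length \<open>j\<close>
  from \<open>u\<close> that leaves \<open>u\<close> outward, known to \<open>u\<close>. As long as \<open>2 (a + i) < g\<close>, every \<open>v\<close> lacks at
  most \<open>n\<close> outward walks of length at most \<open>i\<close>.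

  In order to agree on a radius, every \<open>u\<close> sends to every \<open>v\<close>, for all \<open>i \<le> a\<close> at once, the
  logarithms of the numbers of its outward walks, written as a staircase of \<open>O(log n)\<close> bits. The
  nodes choose the largest \<open>i \<le> a\<close> for which no node has to receive more than \<open>O(n)\<close> walks, so that
  \<open>i = a\<close> or \<open>a + i \<ge> \<lceil>g / 2\<rceil> - 1\<close>, and the girth itself need not be computed.

  For the delivery, \<open>u\<close> gives the walk number \<open>P mod l\<close> of its list of length \<open>l\<close> to the node in
  charge of position \<open>P\<close>. Any \<open>l\<close> consecutive positions then hold the whole list of \<open>u\<close>, so \<open>v\<close>
  reserves disjoint intervals of positions for these nodes \<open>u\<close> and asks each position for a single
  walk; no routing is needed. Since the outward walks depend on the direction in which \<open>v\<close> lies,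
  \<open>u\<close> keeps two lists: all walks, and all walks that avoid its heaviest branch. One of the two is at
  most twice as long as what \<open>v\<close> needs.
\<close>

section \<open>Protocols\<close>

text \<open>A processor does not send to itself. To treat all processors alike, a protocol also has
  messages of a processor to itself, and each processor recomputes its own.\<close>

definition with_self ::
  "('k cc_input \<Rightarrow> history \<Rightarrow> nat \<Rightarrow> bool list) \<Rightarrow> 'k cc_input \<Rightarrow> history \<Rightarrow> history" where
  "with_self F inp h = foldl (\<lambda>H m. H @ [m(ident inp := F inp H (ident inp))]) [] h"

definition protocol ::
  "('k cc_input \<Rightarrow> history \<Rightarrow> nat \<Rightarrow> bool list) \<Rightarrow> ('k cc_input \<Rightarrow> history \<Rightarrow> 'o) \<Rightarrow> ('k, 'o) cc_algorithm" where
  "protocol F out =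
     \<lparr>send = \<lambda>inp h. F inp (with_self F inp h), result = \<lambda>inp h. out inp (with_self F inp h)\<rparr>"

lemma protocol_simps [simp]:
  "send (protocol F out) inp h = F inp (with_self F inp h)"
  "result (protocol F out) inp h = out inp (with_self F inp h)"
  by (simp_all add: protocol_def)

lemma with_self_simps [simp]:
  "with_self F inp [] = []"
  "with_self F inp (h @ [m]) =
     with_self F inp h @ [m(ident inp := F inp (with_self F inp h) (ident inp))]"
  by (simp_all add: with_self_def)

text \<open>The execution with self-messages included; after the next lemma it replaces
  \<open>cc_history\<close> throughout.\<close>

primrec run ::
  "('k cc_input \<Rightarrow> history \<Rightarrow> nat \<Rightarrow> bool list) \<Rightarrow> nat \<Rightarrow> (nat \<Rightarrow> 'k cc_input) \<Rightarrow> nat \<Rightarrow> nat \<Rightarrow> history" where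
  "run F n I 0 v = []"
| "run F n I (Suc r) v = run F n I r v @ [\<lambda>u. if u < n then F (I u) (run F n I r u) v else []]"

lemma with_self_cc_history:
  assumes "\<And>u. u < n \<Longrightarrow> ident (I u) = u" and "v < n"
  shows "with_self F (I v) (cc_history (protocol F out) n I r v) = run F n I r v"
  using assms(2)
proof (induction r arbitrary: v)
  case 0
  show ?case by simp
next
  case (Suc r)
  have "with_self F (I v) (cc_history (protocol F out) n I (Suc r) v) =
    run F n I r v @ [(\<lambda>u. if u < n \<and> u \<noteq> v then F (I u) (run F n I r u) v else [])
      (v := F (I v) (run F n I r v) v)]"
    using Suc.IH Suc.prems assms(1)[OF Suc.prems] by (simp cong: conj_cong if_cong)
  also have "\<dots> = run F n I (Suc r) v"
    using Suc.prems by (auto simp: fun_eq_iff)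
  finally show ?case .
qed

lemma cc_bandwidth_protocol:
  assumes "\<And>u. u < n \<Longrightarrow> ident (I u) = u"
    and "\<And>r u v. r < R \<Longrightarrow> u < n \<Longrightarrow> v < n \<Longrightarrow> real (length (F (I u) (run F n I r u) v)) \<le> B"
  shows "cc_bandwidth (protocol F out) n I R B"
proof -
  have "send (protocol F out) (I u) (cc_history (protocol F out) n I r u) = F (I u) (run F n I r u)"
    if "u < n" for r u
    by (simp add: with_self_cc_history[where n = n and I = I, OF assms(1) that])
  thus ?thesis
    using assms(2) by (simp add: cc_bandwidth_def)
qed

lemma cc_output_protocol:
  assumes "\<And>u. u < n \<Longrightarrow> ident (I u) = u" and "v < n"
  shows "cc_output (protocol F out) n I R v = out (I v) (run F n I R v)"
  by (simp add: cc_output_def with_self_cc_history[where n = n and I = I, OF assms])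

lemma length_run [simp]: "length (run F n I r v) = r"
  by (induction r) auto

lemma run_nth:
  "j < r \<Longrightarrow> run F n I r v ! j = (\<lambda>u. if u < n then F (I u) (run F n I j u) v else [])"
  by (induction r) (auto simp: nth_append less_Suc_eq)

section \<open>Encoding numbers\<close>

text \<open>A nondecreasing list is written as a staircase of unary increments: its length plus its
  last entry many bits suffice, independently of the number of digits of the entries.\<close>

primrec stair :: "nat \<Rightarrow> nat list \<Rightarrow> bool list" where
  "stair c [] = []"
| "stair c (x # xs) = replicate (x - c) True @ False # stair x xs"

primrec unstair :: "nat \<Rightarrow> bool list \<Rightarrow> nat list" where
  "unstair c [] = []"
| "unstair c (b # bs) = (if b then unstair (Suc c) bs else c # unstair c bs)"

lemma unstair_replicate: "unstair c (replicate k True @ bs) = unstair (c + k) bs"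
  by (induction k arbitrary: c) auto

text \<open>Sortedness from \<open>c\<close> on makes the truncated differences \<open>x - c\<close>
  exact, so the counter of \<open>unstair\<close> stands at \<open>x\<close> when it meets the
  closing \<open>False\<close>.\<close>

lemma unstair_stair: "sorted (c # xs) \<Longrightarrow> unstair c (stair c xs) = xs"
  by (induction xs arbitrary: c) (auto simp: unstair_replicate)

lemma length_stair: "sorted (c # xs) \<Longrightarrow> length (stair c xs) = length xs + (last (c # xs) - c)"
proof (induction xs arbitrary: c)
  case (Cons x xs)
  have "x \<le> last (x # xs)"
    using Cons.prems by (auto simp: last_in_set)
  thus ?case using Cons by auto
qed auto

lemma take_drop_concat_uniform:
  assumes "\<And>x. x \<in> set xs \<Longrightarrow> length (f x) = w" and "j < length xs"
  shows "take w (drop (j * w) (concat (map f xs))) = f (xs ! j)"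
  using assms
proof (induction xs arbitrary: j)
  case (Cons x xs)
  show ?case
  proof (cases j)
    case (Suc i)
    thus ?thesis using Cons by (simp add: drop_append)
  qed (use Cons in simp)
qed simp

lemma length_concat_uniform:
  assumes "\<And>x. x \<in> set xs \<Longrightarrow> length (f x) = w"
  shows "length (concat (map f xs)) = length xs * w"
  using assms by (induction xs) auto

definition encode :: "nat \<Rightarrow> nat list \<Rightarrow> bool list" where
  "encode w xs = concat (map (\<lambda>x. map (bit x) [0..<w]) xs)"

definition decode :: "nat \<Rightarrow> bool list \<Rightarrow> nat list" where
  "decode w bs = map (\<lambda>j. horner_sum of_bool 2 (take w (drop (j * w) bs))) [0..<length bs div w]"

lemma length_encode: "length (encode w xs) = length xs * w"
  unfolding encode_def by (rule length_concat_uniform) simp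

lemma decode_encode:
  assumes "0 < w" and "\<And>x. x \<in> set xs \<Longrightarrow> x < 2 ^ w"
  shows "decode w (encode w xs) = xs"
proof (rule nth_equalityI)
  show "length (decode w (encode w xs)) = length xs"
    using assms(1) by (simp add: decode_def length_encode)
  fix j assume "j < length (decode w (encode w xs))"
  hence j: "j < length xs" using assms(1) by (simp add: decode_def length_encode)
  have "take w (drop (j * w) (encode w xs)) = map (bit (xs ! j)) [0..<w]"
    unfolding encode_def by (rule take_drop_concat_uniform) (use j in auto)
  moreover have "take_bit w (xs ! j) = xs ! j"
    using assms(2) j by (simp add: take_bit_nat_eq_self)
  ultimately show "decode w (encode w xs) ! j = xs ! j"
    using j assms(1) by (simp add: decode_def length_encode horner_sum_bit_eq_take_bit)
qed

section \<open>Non-backtracking walks\<close>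

text \<open>Takes a bare edge set, so that the same notion applies to the whole graph and to the
  edges known to one node.\<close>

definition nb_walk :: "'v set set \<Rightarrow> 'v list \<Rightarrow> bool" where
  "nb_walk E p \<longleftrightarrow> p \<noteq> [] \<and> (\<forall>t. Suc t < length p \<longrightarrow> {p ! t, p ! Suc t} \<in> E) \<and>
     (\<forall>t. t + 2 < length p \<longrightarrow> p ! t \<noteq> p ! (t + 2))"

lemma nb_walk_take: "nb_walk E p \<Longrightarrow> 0 < k \<Longrightarrow> nb_walk E (take k p)"
  by (auto simp: nb_walk_def)

lemma nb_walk_drop: "nb_walk E p \<Longrightarrow> k < length p \<Longrightarrow> nb_walk E (drop k p)"
  unfolding nb_walk_def by (auto simp: add.assoc[symmetric])
 
lemma nb_walk_rev:
  assumes "nb_walk E p" shows "nb_walk E (rev p)"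
  unfolding nb_walk_def
proof (intro conjI allI impI)
  show "rev p \<noteq> []" using assms by (simp add: nb_walk_def)
next
  fix t assume t: "Suc t < length (rev p)"
  define s where "s = length p - Suc (Suc t)"
  have "length p - Suc t = Suc s" using t by (simp add: s_def)
  moreover have "{p ! s, p ! Suc s} \<in> E" using assms t by (simp add: nb_walk_def s_def)
  ultimately show "{rev p ! t, rev p ! Suc t} \<in> E"
    using t by (simp add: rev_nth s_def[symmetric] insert_commute)
next
  fix t assume t: "t + 2 < length (rev p)"
  define s where "s = length p - Suc (Suc (Suc t))"
  have "length p - Suc t = Suc (Suc s)" using t by (simp add: s_def)
  moreover have "p ! s \<noteq> p ! Suc (Suc s)" using assms t by (simp add: nb_walk_def s_def)
  ultimately show "rev p ! t \<noteq> rev p ! (t + 2)"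
    using t by (simp add: rev_nth s_def[symmetric])
qed

text \<open>The last two premises treat the two windows of three entries that straddle the
  joint.\<close>

lemma nb_walk_append:
  assumes "nb_walk E p" "nb_walk E q" "{last p, hd q} \<in> E"
    and "2 \<le> length p \<Longrightarrow> p ! (length p - 2) \<noteq> hd q"
    and "2 \<le> length q \<Longrightarrow> last p \<noteq> q ! 1"
  shows "nb_walk E (p @ q)"
  unfolding nb_walk_def
proof (intro conjI allI impI)
  show "p @ q \<noteq> []" using assms(1) by (simp add: nb_walk_def)
next
  have ne: "p \<noteq> []" "q \<noteq> []" using assms by (auto simp: nb_walk_def)
  fix t assume t: "Suc t < length (p @ q)"
  consider "Suc t < length p" | "Suc t = length p" | "length p \<le> t" by linarith
  thus "{(p @ q) ! t, (p @ q) ! Suc t} \<in> E"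
  proof cases
    case 2
    hence "t = length p - 1" by simp
    thus ?thesis using assms(3) ne 2 by (simp add: nth_append last_conv_nth hd_conv_nth)
  next
    case 3
    thus ?thesis using assms(2) t by (auto simp: nb_walk_def nth_append Suc_diff_le)
  qed (use assms(1) in \<open>simp add: nb_walk_def nth_append\<close>)
next
  have ne: "p \<noteq> []" "q \<noteq> []" using assms by (auto simp: nb_walk_def)
  fix t assume t: "t + 2 < length (p @ q)"
  consider "t + 2 < length p" | "t + 2 = length p" | "t + 1 = length p" | "length p \<le> t" by linarith
  thus "(p @ q) ! t \<noteq> (p @ q) ! (t + 2)"
  proof cases
    case 2
    hence "t = length p - 2" "t < length p" "2 \<le> length p" by auto
    thus ?thesis using assms(4) ne 2 by (simp add: nth_append hd_conv_nth)
  next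
    case 3
    hence "t = length p - 1" "t + 2 - length p = 1" "2 \<le> length q" using t by auto
    thus ?thesis using assms(5) ne 3 by (simp add: nth_append last_conv_nth)
  next
    case 4
    hence "t + 2 - length p = t - length p + 2" by simp
    thus ?thesis using assms(2) t 4 by (simp add: nb_walk_def nth_append)
  qed (use assms(1) in \<open>simp add: nb_walk_def nth_append\<close>)
qed

section \<open>Repeated vertices, cycles and uniqueness of short walks\<close>

lemma simple_graph_edgeD:
  assumes "simple_graph G" "{x, y} \<in> edges G"
  shows "x \<noteq> y" "x \<in> verts G" "y \<in> verts G"
proof -
  have "card {x, y} = 2" "{x, y} \<subseteq> verts G" using assms by (auto simp: simple_graph_def)
  thus "x \<noteq> y" "x \<in> verts G" "y \<in> verts G" by auto
qed

text \<open>A repetition with no closer repetition inside it encloses distinct vertices. Its gap is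
  not 1, as there are no loops, and not 2, as the walk does not backtrack, so the segment closes up
  to a cycle.\<close>

lemma nb_walk_repetition_cycle:
  assumes G: "simple_graph G" and p: "nb_walk (edges G) p" and "s < t" "t < length p" "p ! s = p ! t"
  shows "\<exists>c. is_cycle G c \<and> length c \<le> t - s"
  using assms(3-5)
proof (induction "t - s" arbitrary: s t rule: less_induct)
  case less
  show ?case
  proof (cases "\<exists>s' t'. s \<le> s' \<and> s' < t' \<and> t' \<le> t \<and> p ! s' = p ! t' \<and> t' - s' < t - s")
    case True
    then obtain s' t' where st: "s' < t'" "t' \<le> t" "p ! s' = p ! t'" "t' - s' < t - s" by blast
    show ?thesis using less.hyps[OF st(4) st(1) _ st(3)] st less.prems by fastforce
  next
    case False
    define c where "c = take (t - s) (drop s p)"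
    have len: "length c = t - s" using less.prems by (simp add: c_def)
    have nth: "c ! k = p ! (s + k)" if "k < t - s" for k
      using that less.prems by (simp add: c_def)
    have adj: "{p ! k, p ! Suc k} \<in> edges G" if "k < t" for k
      using p that less.prems by (simp add: nb_walk_def)
    have "distinct c"
      unfolding distinct_conv_nth
    proof (intro allI impI)
      have *: "c ! i \<noteq> c ! j" if "i < j" "j < length c" for i j
      proof
        assume "c ! i = c ! j"
        hence "p ! (s + i) = p ! (s + j)" using that len nth by simp
        moreover have "s \<le> s + i" "s + i < s + j" "s + j \<le> t" "s + j - (s + i) < t - s"
          using that len by auto
        ultimately show False using False by blast
      qed
      fix i j assume "i < length c" "j < length c" "i \<noteq> j"
      thus "c ! i \<noteq> c ! j" using *[of i j] *[of j i] by (cases "i < j") force+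
    qed
    moreover have "t - s \<noteq> 1"
    proof
      assume "t - s = 1"
      hence "t = Suc s" by simp
      thus False using simple_graph_edgeD(1)[OF G adj[of s]] less.prems by auto
    qed
    moreover have "t - s \<noteq> 2"
    proof
      assume "t - s = 2"
      hence "t = s + 2" using less.prems by simp
      thus False using p less.prems by (simp add: nb_walk_def)
    qed
    moreover have "is_walk G c"
      unfolding is_walk_def
    proof (intro conjI)
      show "c \<noteq> []" using len less.prems by auto
      show "set c \<subseteq> verts G"
        using simple_graph_edgeD(2)[OF G adj] nth len by (auto simp: in_set_conv_nth)
      show "successively (\<lambda>x y. {x, y} \<in> edges G) c"
        using adj by (auto simp: successively_conv_nth nth len)
    qed
    \<comment> \<open>The closing edge is the step from position \<open>t - 1\<close> to
      \<open>t\<close>, because \<open>p ! t = p ! s\<close>.\<close>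
    moreover have "{last c, hd c} \<in> edges G"
    proof -
      have "c \<noteq> []" using len less.prems by auto
      moreover have "s + (t - s - 1) = t - 1" using less.prems by simp
      ultimately have "last c = p ! (t - 1)" "hd c = p ! t"
        using nth[of "t - s - 1"] nth[of 0] less.prems len by (auto simp: last_conv_nth hd_conv_nth)
      thus ?thesis using adj[of "t - 1"] less.prems by simp
    qed
    ultimately show ?thesis using len less.prems by (intro exI[of _ c]) (auto simp: is_cycle_def)
  qed
qed

lemma girth_le_cycle: "is_cycle G c \<Longrightarrow> girth G \<le> enat (length c)"
  unfolding girth_def by (rule INF_lower) simp

lemma nb_walk_distinct:
  assumes "simple_graph G" "nb_walk (edges G) p" "enat (length p) \<le> girth G"
  shows "distinct p"
proof (rule ccontr)
  assume "\<not> distinct p"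
  then obtain s t where st: "s < t" "t < length p" "p ! s = p ! t"
    unfolding distinct_conv_nth by (metis linorder_neqE_nat)
  then obtain c where "is_cycle G c" "length c \<le> t - s"
    using nb_walk_repetition_cycle[OF assms(1,2)] by blast
  hence "girth G \<le> enat (t - s)" using girth_le_cycle order_trans by fastforce
  hence "enat (length p) \<le> enat (t - s)" using assms(3) order_trans by blast
  thus False using st by simp
qed

text \<open>Two such walks, cut at the end of their common initial part, would close up to a
  non-backtracking walk that starts and ends at the same vertex.\<close>

lemma nb_walk_unique:
  assumes G: "simple_graph G"
    and "nb_walk (edges G) p" "nb_walk (edges G) q" "hd p = hd q" "last p = last q"
    and "enat (length p + length q - 1) \<le> girth G"
  shows "p = q"
  using assms(2-)
proof (induction p arbitrary: q)
  case Nil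
  thus ?case by (simp add: nb_walk_def)
next
  case (Cons y p q')
  then obtain q where q': "q' = y # q" by (cases q') (auto simp: nb_walk_def)
  \<comment> \<open>The bound is the girth bound rewritten: \<open>length (y # p) + length (y # q) -
    1 = length p + length q + 1\<close>.\<close>
  have closed: False if "nb_walk (edges G) r" "hd r = last r" "2 \<le> length r"
    "length r \<le> length p + length q + 1" for r
  proof -
    have "enat (length r) \<le> girth G" using that(4) Cons.prems(5) unfolding q'
      by (auto intro: order_trans[rotated])
    hence "distinct r" using nb_walk_distinct[OF G that(1)] by blast
    thus False using that(2,3) by (cases r) (auto split: if_splits)
  qed
  show ?case
  proof (cases "p = [] \<or> q = []")
    case True
    thus ?thesis
      using closed[OF Cons.prems(1)] closed[OF Cons.prems(2)] Cons.prems(4) unfolding q'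
      by (cases p; cases q) (auto split: if_splits)
  next
    case False
    then obtain b p1 c q1 where bc: "p = b # p1" "q = c # q1" by (meson neq_Nil_conv)
    have nb: "nb_walk (edges G) p" "nb_walk (edges G) q"
      using nb_walk_drop[OF Cons.prems(1), of 1] nb_walk_drop[OF Cons.prems(2), of 1] False
      unfolding q' by auto
    show ?thesis
    proof (cases "b = c")
      case True
      have "enat (length p + length q - 1) \<le> girth G"
        using Cons.prems(5) unfolding q' by (auto intro: order_trans[rotated])
      hence "p = q" using Cons.IH[of q] nb Cons.prems(4) True bc q' by simp
      thus ?thesis by (simp add: q')
    next
      case neq: False
      \<comment> \<open>The first steps \<open>b\<close> and \<open>c\<close> differ, so going back
        along \<open>p\<close> to \<open>y\<close> and out again along \<open>q\<close> does not
        backtrack at \<open>y\<close>.\<close>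
      have "nb_walk (edges G) (rev p @ q')"
      proof (rule nb_walk_append[OF nb_walk_rev[OF nb(1)] Cons.prems(2)])
        have "{(y # p) ! 0, (y # p) ! Suc 0} \<in> edges G"
          using Cons.prems(1) bc unfolding nb_walk_def by (metis length_Cons Suc_less_eq zero_less_Suc)
        thus "{last (rev p), hd q'} \<in> edges G" using bc q' by (simp add: insert_commute)
        assume "2 \<le> length (rev p)"
        hence "rev p ! (length (rev p) - 2) = (y # p) ! 2" "0 + 2 < length (y # p)"
          by (auto simp: rev_nth numeral_2_eq_2)
        moreover have "(y # p) ! 0 \<noteq> (y # p) ! (0 + 2)"
          using Cons.prems(1) calculation(2) unfolding nb_walk_def by blast
        ultimately show "rev p ! (length (rev p) - 2) \<noteq> hd q'" by (simp add: q')
      next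
        show "last (rev p) \<noteq> q' ! 1" using neq bc q' by simp
      qed
      moreover have "hd (rev p @ q') = last (rev p @ q')"
        using Cons.prems(4) False q' by (simp add: hd_rev)
      ultimately show ?thesis using closed[of "rev p @ q'"] False q'
        by (cases p) auto
    qed
  qed
qed

section \<open>Walks, last edges and hop distance\<close>

definition last_edge :: "'v list \<Rightarrow> 'v set" where
  "last_edge p = {p ! (length p - 2), p ! (length p - 1)}"

text \<open>List lengths exceed walk lengths by one: these walks have between 1 and \<open>i\<close>
  edges, so that each of them has a last edge.\<close>

definition nb_from :: "'v set set \<Rightarrow> 'v \<Rightarrow> nat \<Rightarrow> 'v list set" where
  "nb_from E v i = {p. nb_walk E p \<and> hd p = v \<and> 2 \<le> length p \<and> length p \<le> Suc i}"

definition nb_exact :: "'v set set \<Rightarrow> 'v \<Rightarrow> nat \<Rightarrow> 'v list set" where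
  "nb_exact E v k = {p. nb_walk E p \<and> hd p = v \<and> length p = Suc k}"

lemma is_walkI:
  assumes "simple_graph G" "hd p \<in> verts G" "p \<noteq> []"
    and "\<And>t. Suc t < length p \<Longrightarrow> {p ! t, p ! Suc t} \<in> edges G"
  shows "is_walk G p"
proof -
  have "p ! t \<in> verts G" if "t < length p" for t
  proof (cases t)
    case 0
    thus ?thesis using assms(2,3) by (simp add: hd_conv_nth)
  next
    case (Suc s)
    thus ?thesis using simple_graph_edgeD(3)[OF assms(1) assms(4)[of s]] that by simp
  qed
  thus ?thesis using assms(3,4)
    by (auto simp: is_walk_def in_set_conv_nth successively_conv_nth)
qed

lemma is_walk_nth: "is_walk G p \<Longrightarrow> Suc t < length p \<Longrightarrow> {p ! t, p ! Suc t} \<in> edges G"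
  by (auto simp: is_walk_def successively_conv_nth)

lemma hop_dist_le_walk:
  "is_walk G p \<Longrightarrow> hop_dist G (hd p) (last p) \<le> enat (length p - 1)"
  unfolding hop_dist_def by (rule INF_lower) simp

lemma hop_dist_walk:
  assumes "hop_dist G v u \<le> enat k"
  shows "\<exists>p. is_walk G p \<and> hd p = v \<and> last p = u \<and> length p \<le> Suc k"
proof -
  have "hop_dist G v u < enat (Suc k)" using assms by (simp add: order_le_less_trans)
  then obtain p where "is_walk G p" "hd p = v" "last p = u" "length p - 1 < Suc k"
    unfolding hop_dist_def INF_less_iff by auto
  thus ?thesis by (intro exI[of _ p]) auto
qed

text \<open>Without its last vertex the walk has at most \<open>r - 1\<close> edges, so the
  penultimate vertex is closer than \<open>r\<close>. The walk may backtrack.\<close>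

lemma last_edge_nbhd:
  assumes G: "simple_graph G" and p: "is_walk G p" "2 \<le> length p" "length p \<le> Suc r"
  shows "last_edge p \<in> edges (nbhd G r (hd p))"
proof -
  have sp: "Suc (length p - 2) = length p - 1" using p by simp
  have ne: "p \<noteq> []" using p by auto
  have len: "length (butlast p) = length p - 1" by simp
  have bne: "butlast p \<noteq> []" using p(2) len by (metis One_nat_def diff_is_0_eq list.size(3) not_less_eq_eq numeral_2_eq_2)
  have hdb: "hd (butlast p) = hd p" using bne by (metis hd_append2 append_butlast_last_id ne)
  have hv: "hd p \<in> verts G" using p(1) ne by (auto simp: is_walk_def)
  have "is_walk G (butlast p)"
    by (rule is_walkI[OF G]) (use bne hdb hv is_walk_nth[OF p(1)] in \<open>auto simp: nth_butlast\<close>)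
  from hop_dist_le_walk[OF this] have
    "hop_dist G (hd p) (p ! (length p - 2)) \<le> enat (length p - 2)"
    using hdb bne p(2) nth_butlast[of "length p - 2" p] by (simp add: last_conv_nth numeral_2_eq_2)
  also have "\<dots> < enat r" using p by simp
  finally have "hop_dist G (hd p) (p ! (length p - 2)) < enat r" .
  moreover have "last_edge p \<in> edges G"
    using is_walk_nth[OF p(1), of "length p - 2"] p(2) sp by (simp add: last_edge_def)
  ultimately show ?thesis by (auto simp: nbhd_def last_edge_def)
qed

lemma nb_walk_is_walk:
  assumes "simple_graph G" "nb_walk (edges G) p" "hd p \<in> verts G"
  shows "is_walk G p"
  using assms by (intro is_walkI) (auto simp: nb_walk_def)

text \<open>Cutting out a detour \<open>x, y, x\<close> keeps both ends and shortens the walk by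
  two; induction on the length.\<close>

lemma shortest_walk_nb_walk:
  assumes "is_walk G p"
  shows "\<exists>q. is_walk G q \<and> nb_walk (edges G) q \<and> hd q = hd p \<and> last q = last p \<and> length q \<le> length p"
  using assms
proof (induction "length p" arbitrary: p rule: less_induct)
  case less
  show ?case
  proof (cases "\<exists>t. t + 2 < length p \<and> p ! t = p ! (t + 2)")
    case False
    thus ?thesis using less.prems is_walk_nth[OF less.prems]
      by (intro exI[of _ p]) (auto simp: nb_walk_def is_walk_def)
  next
    case True
    then obtain t where t: "t + 2 < length p" "p ! t = p ! (t + 2)" by blast
    define q where "q = take t p @ drop (t + 2) p"
    have q: "q ! s = (if s < t then p ! s else p ! (s + 2))" if "s < length q" for s
      using t that by (auto simp: q_def nth_append min_def algebra_simps)
    have len: "length q = length p - 2" using t by (simp add: q_def)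
    have ne: "q \<noteq> []" "p \<noteq> []" using len t by auto
    have "set q \<subseteq> set p" by (auto simp: q_def dest: in_set_takeD in_set_dropD)
    moreover have "{q ! s, q ! Suc s} \<in> edges G" if s: "Suc s < length q" for s
    proof (cases "s < t")
      case True
      hence "q ! Suc s = p ! Suc s" using q[OF s] t(2) by (cases "Suc s = t") auto
      thus ?thesis using is_walk_nth[OF less.prems, of s] q[of s] s True len t by simp
    next
      case False
      thus ?thesis using is_walk_nth[OF less.prems, of "s + 2"] q[of s] q[OF s] s len by simp
    qed
    ultimately have "is_walk G q"
      using less.prems ne by (auto simp: is_walk_def successively_conv_nth)
    moreover have "hd q = hd p"
      using q[of 0] ne t len by (cases "t = 0") (auto simp: hd_conv_nth)
    moreover have "last q = last p"
      using t by (simp add: q_def last_append)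
    moreover have "length q < length p" using len t by simp
    ultimately show ?thesis using less.hyps[of q] by fastforce
  qed
qed

section \<open>Neighborhoods in terms of walks\<close>

text \<open>An edge of the neighborhood has an end \<open>u\<close> that a non-backtracking walk
  with fewer than \<open>r\<close> edges reaches. Either this walk already ends with the edge, or
  the edge prolongs it.\<close>

lemma edges_nbhd:
  assumes G: "simple_graph G" and v: "v \<in> verts G"
  shows "edges (nbhd G r v) = last_edge ` nb_from (edges G) v r"
proof (intro equalityI subsetI)
  fix e assume "e \<in> last_edge ` nb_from (edges G) v r"
  thus "e \<in> edges (nbhd G r v)"
    using last_edge_nbhd[OF G nb_walk_is_walk[OF G]] v by (auto simp: nb_from_def)
next
  fix e assume "e \<in> edges (nbhd G r v)"
  then obtain u where e: "e \<in> edges G" "u \<in> e" "hop_dist G v u < enat r"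
    by (auto simp: nbhd_def)
  hence r: "0 < r" by (cases r) (auto simp: zero_enat_def[symmetric])
  have "hop_dist G v u \<le> enat (r - 1)"
    using e(3) r by (cases "hop_dist G v u") auto
  then obtain p0 where "is_walk G p0" "hd p0 = v" "last p0 = u" "length p0 \<le> r"
    using hop_dist_walk[of G v u "r - 1"] r by auto
  then obtain p where p: "is_walk G p" "nb_walk (edges G) p" "hd p = v" "last p = u" "length p \<le> r"
    using shortest_walk_nb_walk by (metis order_trans)
  have "card e = 2" using G e(1) by (simp add: simple_graph_def)
  then obtain y where y: "e = {u, y}" "y \<noteq> u"
    using e(2) by (metis card_2_iff insert_commute insert_iff singletonD)
  have ne: "p \<noteq> []" using p by (auto simp: nb_walk_def)
  show "e \<in> last_edge ` nb_from (edges G) v r"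
  proof (cases "2 \<le> length p \<and> p ! (length p - 2) = y")
    case True
    hence "last_edge p = e" using p(4) y ne by (simp add: last_edge_def last_conv_nth insert_commute)
    thus ?thesis using p True by (force simp: nb_from_def)
  next
    case False
    have "nb_walk (edges G) (p @ [y])"
      by (rule nb_walk_append) (use p(2,4) e(1) y False in \<open>auto simp: nb_walk_def\<close>)
    hence "p @ [y] \<in> nb_from (edges G) v r"
      using p ne by (cases p) (auto simp: nb_from_def)
    moreover have "(p @ [y]) ! (length p - 1) = u"
      using ne p(4) by (simp add: nth_append last_conv_nth)
    hence "e = last_edge (p @ [y])" by (simp add: last_edge_def y(1))
    ultimately show ?thesis by (rule rev_image_eqI)
  qed
qed

text \<open>Lets a node rebuild the graph from its edges: any other vertex lies on the last edge of
  a walk to it, and \<open>v\<close> is added because it may lie on no edge.\<close>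

lemma verts_nbhd:
  assumes G: "simple_graph G" and v: "v \<in> verts G"
  shows "verts (nbhd G r v) = insert v (\<Union> (edges (nbhd G r v)))"
proof (intro equalityI subsetI)
  fix y assume y: "y \<in> verts (nbhd G r v)"
  hence "hop_dist G v y \<le> enat r" by (simp add: nbhd_def)
  from hop_dist_walk[OF this]
  obtain p where p: "is_walk G p" "hd p = v" "last p = y" "length p \<le> Suc r" by blast
  show "y \<in> insert v (\<Union> (edges (nbhd G r v)))"
  proof (cases "2 \<le> length p")
    case True
    have "y \<in> last_edge p" using p True by (cases "p = []") (auto simp: last_edge_def last_conv_nth)
    thus ?thesis using last_edge_nbhd[OF G p(1) True p(4)] p(2) by blast
  next
    case False
    thus ?thesis using p by (cases p) (auto simp: is_walk_def Suc_le_eq)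
  qed
next
  have walk: "y \<in> verts (nbhd G r v)" if "is_walk G p" "hd p = v" "last p = y" "length p \<le> Suc r" for p y
  proof -
    have "hop_dist G v y \<le> enat (length p - 1)" using hop_dist_le_walk[OF that(1)] that by simp
    also have "\<dots> \<le> enat r" using that by simp
    finally show ?thesis using that(1,3) by (auto simp: nbhd_def is_walk_def)
  qed
  fix y assume "y \<in> insert v (\<Union> (edges (nbhd G r v)))"
  then consider "y = v" | p where "p \<in> nb_from (edges G) v r" "y \<in> last_edge p"
    using edges_nbhd[OF G v] by auto
  thus "y \<in> verts (nbhd G r v)"
  proof cases
    case 1
    thus ?thesis using v by (intro walk[of "[v]"]) (auto simp: is_walk_def)
  next
    case 2
    hence p: "nb_walk (edges G) p" "hd p = v" "2 \<le> length p" "length p \<le> Suc r" by (auto simp: nb_from_def)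
    have "nb_walk (edges G) (take (length p - 1) p)" by (rule nb_walk_take) (use p in auto)
    moreover have "hd (take (length p - 1) p) = v" using p by (simp add: hd_take)
    moreover have "last (take (length p - 1) p) = p ! (length p - 2)"
      using p by (cases "p = []") (auto simp: last_conv_nth min_def numeral_2_eq_2)
    moreover have "last p = p ! (length p - 1)" using p by (cases "p = []") (auto simp: last_conv_nth)
    moreover have "y = p ! (length p - 2) \<or> y = p ! (length p - 1)" using 2 by (auto simp: last_edge_def)
    ultimately show ?thesis
      using walk[of "take (length p - 1) p" y] walk[of p y] p v
        nb_walk_is_walk[OF G p(1)] nb_walk_is_walk[OF G, of "take (length p - 1) p"] by fastforce
  qed
qed

lemma nbhd_eqI:
  assumes "simple_graph G" "v \<in> verts G" "E = edges (nbhd G r v)"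
  shows "\<lparr>verts = insert v (\<Union> E), edges = E\<rparr> = nbhd G r v"
  using verts_nbhd[OF assms(1,2), of r] assms(3) by simp

text \<open>Each edge of \<open>p\<close> is the last edge of a prefix with at most \<open>a\<close>
  edges, hence is known to \<open>hd p\<close>.\<close>

lemma nb_walk_nbhd_iff:
  assumes G: "simple_graph G" and p: "p \<noteq> []" "hd p \<in> verts G" "length p \<le> Suc a"
  shows "nb_walk (edges (nbhd G a (hd p))) p \<longleftrightarrow> nb_walk (edges G) p"
proof
  assume "nb_walk (edges (nbhd G a (hd p))) p"
  thus "nb_walk (edges G) p" by (auto simp: nb_walk_def nbhd_def)
next
  assume nb: "nb_walk (edges G) p"
  have "{p ! t, p ! Suc t} \<in> edges (nbhd G a (hd p))" if "Suc t < length p" for t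
  proof -
    have len: "length (take (t + 2) p) = t + 2" using that by simp
    have "last_edge (take (t + 2) p) = {p ! t, p ! Suc t}"
      unfolding last_edge_def len by simp
    moreover have "hd (take (t + 2) p) = hd p" by (simp add: hd_take)
    moreover have "is_walk G (take (t + 2) p)"
      by (rule nb_walk_is_walk[OF G nb_walk_take[OF nb]]) (use p in \<open>simp_all add: hd_take\<close>)
    ultimately show ?thesis
      using last_edge_nbhd[OF G, of "take (t + 2) p" a] len p(3) that by simp
  qed
  thus "nb_walk (edges (nbhd G a (hd p))) p" using nb by (simp add: nb_walk_def)
qed

lemma nb_from_nbhd:
  assumes "simple_graph G" "v \<in> verts G" "i \<le> a"
  shows "nb_from (edges (nbhd G a v)) v i = nb_from (edges G) v i"
proof -
  have "nb_walk (edges (nbhd G a v)) p \<longleftrightarrow> nb_walk (edges G) p"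
    if "hd p = v" "2 \<le> length p" "length p \<le> Suc i" for p
    using nb_walk_nbhd_iff[OF assms(1), of p a] assms that by (cases "p = []") auto
  thus ?thesis unfolding nb_from_def by blast
qed

lemma nb_exact_nbhd:
  assumes "simple_graph G" "v \<in> verts G"
  shows "nb_exact (edges (nbhd G a v)) v a = nb_exact (edges G) v a"
proof -
  have "nb_walk (edges (nbhd G a v)) p \<longleftrightarrow> nb_walk (edges G) p"
    if "hd p = v" "length p = Suc a" for p
    using nb_walk_nbhd_iff[OF assms(1), of p a] assms that by (cases "p = []") auto
  thus ?thesis unfolding nb_exact_def by blast
qed

text \<open>A cycle of length at most \<open>2 * a\<close> lies entirely in the neighborhood of any
  of its vertices, since one of the two directions around it reaches each vertex within
  \<open>a\<close> steps.\<close>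

lemma girth_gt_of_tree_nbhds:
  assumes G: "simple_graph G" and tree: "\<forall>v\<in>verts G. is_tree (nbhd G a v)"
    and g: "girth G = enat g"
  shows "2 * a < g"
proof (rule ccontr)
  assume "\<not> 2 * a < g"
  \<comment> \<open>The strict bound yields a cycle that attains the infimum.\<close>
  have "girth G < enat (Suc g)" using g by simp
  then obtain c where c: "is_cycle G c" "length c \<le> g"
    unfolding girth_def INF_less_iff by auto
  have len: "3 \<le> length c" "length c \<le> 2 * a"
    using c \<open>\<not> 2 * a < g\<close> by (auto simp: is_cycle_def)
  have w: "is_walk G c" using c by (simp add: is_cycle_def)
  define v where "v = hd c"
  have ne: "c \<noteq> []" using len by auto
  hence v: "v \<in> verts G" using w by (auto simp: v_def is_walk_def)
  have adj: "{c ! t, c ! Suc t} \<in> edges G" if "Suc t < length c" for t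
    using is_walk_nth[OF w that] .
  have closing: "{last c, hd c} \<in> edges G" using c by (simp add: is_cycle_def)
  have fwd: "hop_dist G v (c ! t) \<le> enat t" if "t < length c" for t
  proof -
    have "is_walk G (take (Suc t) c)"
      by (rule is_walkI[OF G]) (use that ne v adj in \<open>auto simp: v_def\<close>)
    moreover have "last (take (Suc t) c) = c ! t" using that by (simp add: take_Suc_conv_app_nth)
    moreover have "length (take (Suc t) c) = Suc t" using that by simp
    ultimately show ?thesis
      using hop_dist_le_walk[of G "take (Suc t) c"] by (simp add: v_def hd_take)
  qed
  have bwd: "hop_dist G v (c ! t) \<le> enat (length c - t)" if "t < length c" for t
  proof -
    have "is_walk G (v # rev (drop t c))"
    proof (rule is_walkI[OF G])
      fix s assume s: "Suc s < length (v # rev (drop t c))"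
      show "{(v # rev (drop t c)) ! s, (v # rev (drop t c)) ! Suc s} \<in> edges G"
      proof (cases s)
        case 0
        thus ?thesis using closing that ne by (simp add: v_def rev_nth last_conv_nth insert_commute)
      next
        case (Suc s')
        have "t + (length c - t - Suc s') = Suc (t + (length c - t - Suc (Suc s')))"
          using s Suc by simp
        thus ?thesis using adj[of "t + (length c - t - Suc (Suc s'))"] s Suc
          by (simp add: rev_nth insert_commute)
      qed
    qed (use v in auto)
    from hop_dist_le_walk[OF this] show ?thesis
      using that by (simp add: last_rev hd_drop_conv_nth)
  qed
  let ?N = "nbhd G a v"
  have "c ! t \<in> verts ?N" if t: "t < length c" for t
  proof -
    have "hop_dist G v (c ! t) \<le> enat a"
    proof (cases "t \<le> a")
      case True
      thus ?thesis using fwd[OF t] order_trans by fastforce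
    next
      case False
      hence "enat (length c - t) \<le> enat a" using len by simp
      thus ?thesis using bwd[OF t] order_trans by blast
    qed
    moreover have "c ! t \<in> verts G" using w t by (auto simp: is_walk_def)
    ultimately show ?thesis by (simp add: nbhd_def)
  qed
  moreover have "{c ! t, c ! Suc t} \<in> edges ?N" if t: "Suc t < length c" for t
  \<comment> \<open>One end must be strictly closer than \<open>a\<close>: the earlier end going
    forward, or the later end going backward.\<close>
  proof (cases "t < a")
    case True
    have "hop_dist G v (c ! t) < enat a"
      using fwd[of t] t True by (metis Suc_lessD enat_ord_simps(2) order_le_less_trans)
    thus ?thesis using adj[OF t] by (auto simp: nbhd_def)
  next
    case False
    have "length c - Suc t < a" using False len t by simp
    hence "hop_dist G v (c ! Suc t) < enat a"
      using bwd[OF t] by (metis enat_ord_simps(2) order_le_less_trans)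
    thus ?thesis using adj[OF t] by (auto simp: nbhd_def)
  qed
  moreover have "{last c, hd c} \<in> edges ?N"
  proof -
    have "hop_dist G v (c ! 0) \<le> enat 0" using fwd[of 0] ne by simp
    also have "\<dots> < enat a" using len by simp
    finally have "hop_dist G v (hd c) < enat a" using ne by (simp add: hd_conv_nth)
    thus ?thesis using closing by (auto simp: nbhd_def)
  qed
  ultimately have "is_cycle ?N c"
    using c ne by (auto simp: is_cycle_def is_walk_def successively_conv_nth in_set_conv_nth)
  thus False using tree v by (auto simp: is_tree_def)
qed

section \<open>Outward walks\<close>

text \<open>These are the vertices at distance exactly \<open>a\<close> when \<open>2 * a\<close> is
  less than the girth.\<close>

definition sphere :: "'v set set \<Rightarrow> 'v \<Rightarrow> nat \<Rightarrow> 'v set" where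
  "sphere E v a = last ` nb_exact E v a"

text \<open>Here \<open>z\<close> is meant as the neighbor of \<open>u\<close> in the direction of
  some \<open>v\<close>; the remaining walks prolong a walk from \<open>v\<close> to
  \<open>u\<close> without backtracking.\<close>

definition outward :: "'v set set \<Rightarrow> 'v \<Rightarrow> nat \<Rightarrow> 'v \<Rightarrow> 'v list set" where
  "outward E u i z = {q \<in> nb_from E u i. q ! 1 \<noteq> z}"

definition branch :: "'v set set \<Rightarrow> 'v \<Rightarrow> nat \<Rightarrow> 'v \<Rightarrow> 'v list set" where
  "branch E u i z = {q \<in> nb_from E u i. q ! 1 = z}"

text \<open>The choice is unambiguous when \<open>2 * a\<close> is less than the girth, and arbitrary if \<open>v\<close> is not on
  the sphere of \<open>u\<close>.\<close>

definition toward :: "'v set set \<Rightarrow> 'v \<Rightarrow> nat \<Rightarrow> 'v \<Rightarrow> 'v" where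
  "toward E u a v = (SOME p. p \<in> nb_exact E u a \<and> last p = v) ! 1"

text \<open>Depends on \<open>u\<close> and \<open>i\<close> but not on the recipient, so that a
  single additional list serves all recipients.\<close>

definition heavy :: "'v set set \<Rightarrow> 'v \<Rightarrow> nat \<Rightarrow> 'v" where
  "heavy E u i = (SOME h. \<forall>z. card (branch E u i z) \<le> card (branch E u i h))"

text \<open>The list of \<open>u\<close> that serves direction \<open>z\<close>. Walks in it that
  lead back through \<open>z\<close> are harmless, as their last edges belong to the enlarged
  neighborhood as well.\<close>

definition stock :: "'v set set \<Rightarrow> 'v \<Rightarrow> nat \<Rightarrow> 'v \<Rightarrow> 'v list set" where
  "stock E u i z = (if z = heavy E u i then outward E u i z else nb_from E u i)"

lemma outward_subset_stock: "outward E u i z \<subseteq> stock E u i z"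
  by (auto simp: stock_def outward_def)

lemma stock_subset: "stock E u i z \<subseteq> nb_from E u i"
  by (auto simp: stock_def outward_def)

lemma outward_mono: "i \<le> j \<Longrightarrow> outward E u i z \<subseteq> outward E u j z"
  by (auto simp: outward_def nb_from_def)

text \<open>A branch other than the heaviest contains at most half of the walks.\<close>

lemma card_stock_le:
  assumes fin: "finite (nb_from E u i)"
  shows "card (stock E u i z) \<le> 2 * card (outward E u i z)"
proof (cases "z = heavy E u i")
  case False
  let ?B = "branch E u i" and ?h = "heavy E u i"
  have "card (?B x) \<le> card (nb_from E u i)" for x
    by (rule card_mono[OF fin]) (auto simp: branch_def)
  hence "\<exists>h. \<forall>x. card (?B x) \<le> card (?B h)"
    using ex_has_greatest_nat[of "\<lambda>_. True" _ "\<lambda>x. card (?B x)" "Suc (card (nb_from E u i))"]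
    by (auto simp: less_Suc_eq_le)
  hence "card (?B z) \<le> card (?B ?h)"
    unfolding heavy_def by (rule someI2_ex) blast
  \<comment> \<open>As \<open>z\<close> is not the heaviest direction, the heaviest branch consists
    of outward walks.\<close>
  also have "\<dots> \<le> card (outward E u i z)"
    using False fin by (intro card_mono) (auto simp: branch_def outward_def)
  finally have "card (?B z) \<le> card (outward E u i z)" .
  moreover have "nb_from E u i = ?B z \<union> outward E u i z"
    by (auto simp: branch_def outward_def)
  hence "card (nb_from E u i) \<le> card (?B z) + card (outward E u i z)"
    by (metis card_Un_le)
  ultimately show ?thesis using False by (simp add: stock_def)
qed (simp add: stock_def)

text \<open>The number \<open>2 ^ lg m - 1\<close> approximates \<open>m\<close> from below within a factor of two, also for
  \<open>m = 0\<close>.\<close>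

definition lg :: "nat \<Rightarrow> nat" where
  "lg m = floorlog 2 (Suc m) - 1"

lemma lg_bounds: "2 ^ lg m \<le> Suc m" "Suc m < 2 * 2 ^ lg m"
proof -
  have "0 < floorlog 2 (Suc m)" by (simp add: floorlog_eq_zero_iff zero_less_iff_neq_zero)
  hence "2 * 2 ^ lg m = (2 :: nat) ^ floorlog 2 (Suc m)"
    by (cases "floorlog 2 (Suc m)") (auto simp: lg_def)
  thus "2 ^ lg m \<le> Suc m" "Suc m < 2 * 2 ^ lg m"
    using floorlog_bounds[of "Suc m" 2] by (auto simp: lg_def)
qed

lemma lg_mono: "m \<le> m' \<Longrightarrow> lg m \<le> lg m'"
  unfolding lg_def by (intro diff_le_mono floorlog_mono) simp

section \<open>Counting and composing walks below the girth\<close>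

locale girth_instance =
  fixes n :: nat and G :: "nat ugraph" and g a :: nat
  assumes simple: "simple_graph G" and verts_eq: "verts G = {..<n}"
    and girth: "girth G = enat g" and girth_small: "real g < log 2 (real n)"
    and a_pos: "0 < a" and trees: "\<forall>v\<in>verts G. is_tree (nbhd G a v)"
begin

abbreviation (input) E :: "nat set set" where "E \<equiv> edges G"

lemma two_a_less: "2 * a < g"
  using girth_gt_of_tree_nbhds[OF simple trees girth] .

text \<open>From \<open>g > 2 * a\<close>. The bounds absorb additive constants into multiples of
  the logarithm and make messages of about \<open>a\<close> bits admissible.\<close>

lemma n_ge: "8 \<le> n" and log_ge: "3 \<le> log 2 (real n)"
  and a_less_log: "real a < log 2 (real n)"
proof -
  have "3 \<le> g" using two_a_less a_pos by simp
  thus 1: "3 \<le> log 2 (real n)" using girth_small by simp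
  have "real a < real g" using two_a_less by simp
  thus "real a < log 2 (real n)" using girth_small by simp
  have "0 < real n" using 1 by (cases "n = 0") (auto simp: log_def)
  hence "2 powr 3 \<le> real n" using 1 by (simp add: le_log_iff)
  thus "8 \<le> n" by simp
qed

lemma nb_walk_last_less: "nb_walk E p \<Longrightarrow> hd p < n \<Longrightarrow> last p < n"
  using nb_walk_is_walk[OF simple, of p] verts_eq last_in_set[of p]
  unfolding is_walk_def by (metis lessThan_iff subsetD)

lemma sphere_less: "v < n \<Longrightarrow> u \<in> sphere E v a \<Longrightarrow> u < n"
  using nb_walk_last_less by (auto simp: sphere_def nb_exact_def)

lemma finite_sphere: "v < n \<Longrightarrow> finite (sphere E v a)"
  by (rule finite_subset[of _ "{..<n}"]) (auto dest: sphere_less)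

lemma unique:
  assumes "nb_walk E p" "nb_walk E q" "hd p = hd q" "last p = last q" "length p + length q \<le> Suc g"
  shows "p = q"
  using nb_walk_unique[OF simple assms(1-4)] assms(5) girth by simp

text \<open>Two such walks have at most \<open>2 * i\<close> edges together, so by uniqueness a walk
  is determined by its end.\<close>

lemma card_nb_from:
  assumes "2 * i < g" "v < n"
  shows "finite (nb_from E v i)" "card (nb_from E v i) \<le> n"
proof -
  have inj: "inj_on last (nb_from E v i)"
    by (rule inj_onI, rule unique) (use assms in \<open>auto simp: nb_from_def\<close>)
  have sub: "last ` nb_from E v i \<subseteq> {..<n}"
    using nb_walk_last_less assms(2) by (auto simp: nb_from_def)
  show "finite (nb_from E v i)" using inj sub by (rule inj_on_finite) simp
  show "card (nb_from E v i) \<le> n" using card_inj_on_le[OF inj sub] by simp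
qed

text \<open>The reversed walk is the only candidate for the choice in \<open>toward\<close>, by
  uniqueness.\<close>

lemma toward_eq:
  assumes p: "p \<in> nb_exact E v a"
  shows "toward E (last p) a v = p ! (a - 1)"
proof -
  have len: "length p = Suc a" "p \<noteq> []" using p by (auto simp: nb_exact_def)
  have nb: "nb_walk E (rev p)" using p nb_walk_rev by (auto simp: nb_exact_def)
  have r: "rev p \<in> nb_exact E (last p) a \<and> last (rev p) = v"
    using p nb len by (auto simp: nb_exact_def hd_rev last_rev)
  have "(SOME q. q \<in> nb_exact E (last p) a \<and> last q = v) = rev p"
  proof (rule some_equality[of "\<lambda>q. q \<in> nb_exact E (last p) a \<and> last q = v", OF r])
    fix q assume "q \<in> nb_exact E (last p) a \<and> last q = v"
    thus "q = rev p"
      using r two_a_less by (intro unique) (auto simp: nb_exact_def)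
  qed
  thus ?thesis using len a_pos by (simp add: toward_def rev_nth)
qed

text \<open>By \<open>toward_eq\<close> the direction forbidden to \<open>q\<close> is the vertex
  that \<open>p\<close> visits just before its end, so the joint does not backtrack. The shared
  vertex is removed by \<open>tl\<close>.\<close>

lemma nb_walk_join:
  assumes p: "p \<in> nb_exact E v a" and q: "q \<in> outward E (last p) i (toward E (last p) a v)"
  shows "nb_walk E (p @ tl q)" "hd (p @ tl q) = v" "last (p @ tl q) = last q"
    "length (p @ tl q) \<le> Suc (a + i)"
proof -
  have p': "nb_walk E p" "length p = Suc a" "hd p = v" "p \<noteq> []" using p by (auto simp: nb_exact_def)
  have q': "nb_walk E q" "hd q = last p" "2 \<le> length q" "length q \<le> Suc i" "q ! 1 \<noteq> p ! (a - 1)"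
    using q toward_eq[OF p] by (auto simp: outward_def nb_from_def)
  obtain x y r where xy: "q = x # y # r"
    using q'(3) by (cases q; cases "tl q") auto
  have "{q ! 0, q ! Suc 0} \<in> E" using q'(1,3) unfolding nb_walk_def by auto
  hence adj: "{x, y} \<in> E" using xy by simp
  have x: "x = last p" using q'(2) xy by simp
  show "nb_walk E (p @ tl q)"
  proof (rule nb_walk_append[OF p'(1)])
    show "nb_walk E (tl q)" using nb_walk_drop[OF q'(1), of 1] xy by simp
    show "{last p, hd (tl q)} \<in> E" using adj x xy by simp
    show "p ! (length p - 2) \<noteq> hd (tl q)"
      using q'(5) p'(2) xy by (simp add: numeral_2_eq_2)
    assume "2 \<le> length (tl q)"
    hence "0 + 2 < length q" "r \<noteq> []" using xy by auto
    hence "q ! 0 \<noteq> q ! (0 + 2)" using q'(1) unfolding nb_walk_def by blast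
    thus "last p \<noteq> tl q ! 1" using x xy by simp
  qed
  show "hd (p @ tl q) = v" "last (p @ tl q) = last q" "length (p @ tl q) \<le> Suc (a + i)"
    using p' q' xy by auto
qed

text \<open>The joined walks have at most \<open>a + i\<close> edges each, so by uniqueness
  different pairs of \<open>u\<close> and \<open>q\<close> lead to different ends, and there are
  only \<open>n\<close> vertices.\<close>

lemma sum_outward_le:
  assumes i: "2 * (a + i) < g" and v: "v < n"
  shows "(\<Sum>u\<in>sphere E v a. card (outward E u i (toward E u a v))) \<le> n"
proof -
  let ?O = "\<lambda>u. outward E u i (toward E u a v)"
  have fin: "finite (?O u)" if "u \<in> sphere E v a" for u
    using card_nb_from(1)[of i u] i sphere_less[OF v that] by (auto simp: outward_def)
  have inj: "inj_on (\<lambda>(u, q). last q) (Sigma (sphere E v a) ?O)"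
  proof (rule inj_onI, clarify)
    fix u q u' q'
    assume u: "u \<in> sphere E v a" "q \<in> ?O u" and u': "u' \<in> sphere E v a" "q' \<in> ?O u'"
      and eq: "last q = last q'"
    obtain p p' where p: "p \<in> nb_exact E v a" "u = last p" and p': "p' \<in> nb_exact E v a" "u' = last p'"
      using u(1) u'(1) by (auto simp: sphere_def)
    note j = nb_walk_join[OF p(1) u(2)[unfolded p(2)]]
    note j' = nb_walk_join[OF p'(1) u'(2)[unfolded p'(2)]]
    have "p @ tl q = p' @ tl q'"
      by (rule unique[OF j(1) j'(1)]) (use j j' eq i in auto)
    \<comment> \<open>Both first parts have \<open>Suc a\<close> entries, so the joined walk can be
      split in one way only.\<close>
    moreover have "length p = length p'" using p p' by (simp add: nb_exact_def)
    ultimately have "p = p'" "tl q = tl q'" by auto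
    moreover have "hd q = u" "hd q' = u'" "q \<noteq> []" "q' \<noteq> []"
      using u(2) u'(2) by (auto simp: outward_def nb_from_def)
    ultimately show "u = u' \<and> q = q'" using p p' by (metis list.collapse)
  qed
  have "(\<Sum>u\<in>sphere E v a. card (?O u)) = card (Sigma (sphere E v a) ?O)"
    using finite_sphere[OF v] fin by simp
  also have "\<dots> \<le> card {..<n}"
  proof (rule card_inj_on_le[OF inj])
    show "(\<lambda>(u, q). last q) ` Sigma (sphere E v a) ?O \<subseteq> {..<n}"
      using sphere_less[OF v] nb_walk_last_less by (fastforce simp: outward_def nb_from_def)
  qed simp
  finally show ?thesis by simp
qed

text \<open>Cut the walk after \<open>a\<close> edges; that it does not backtrack at the cut makes
  the remainder outward.\<close>

lemma nb_from_split:
  assumes "q \<in> nb_from E v (a + i)" "q \<notin> nb_from E v a"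
  obtains u r where "u \<in> sphere E v a" "r \<in> outward E u i (toward E u a v)" "last_edge r = last_edge q"
proof -
  have q: "nb_walk E q" "hd q = v" "length q \<le> Suc (a + i)" "Suc (Suc a) \<le> length q"
    using assms by (auto simp: nb_from_def)
  define p where "p = take (Suc a) q"
  have len: "length p = Suc a" using q by (simp add: p_def)
  have p: "p \<in> nb_exact E v a"
    using q nb_walk_take[OF q(1), of "Suc a"] len by (simp add: p_def nb_exact_def hd_take)
  have lp: "last p = q ! a" using q by (simp add: p_def take_Suc_conv_app_nth)
  define r where "r = drop a q"
  have lr: "length r = length q - a" by (simp add: r_def)
  have "nb_walk E r" using nb_walk_drop[OF q(1), of a] q by (simp add: r_def)
  moreover have "hd r = last p" using q by (simp add: r_def lp hd_drop_conv_nth)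
  moreover have "r ! 1 \<noteq> p ! (a - 1)"
  proof -
    have "a - 1 + 2 < length q" using q(4) a_pos by simp
    hence "q ! (a - 1) \<noteq> q ! (a - 1 + 2)" using q(1) unfolding nb_walk_def by blast
    moreover have "a - 1 + 2 = a + 1" using a_pos by simp
    ultimately show ?thesis using q a_pos by (simp add: r_def p_def)
  qed
  ultimately have "r \<in> outward E (last p) i (toward E (last p) a v)"
    using toward_eq[OF p] q lr by (auto simp: outward_def nb_from_def)
  moreover have "last_edge r = last_edge q"
    using q by (simp add: last_edge_def lr) (simp add: r_def)
  ultimately show ?thesis using that p by (auto simp: sphere_def)
qed

text \<open>Outward walks suffice by \<open>nb_from_split\<close>, and any further walk of at most
  \<open>i\<close> edges from the sphere adds nothing foreign. This leaves freedom in the choice of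
  the lists sent.\<close>

lemma edges_nbhd_add:
  assumes v: "v < n" and X: "\<And>u. u \<in> sphere E v a \<Longrightarrow> outward E u i (toward E u a v) \<subseteq> X u"
    and X': "\<And>u. u \<in> sphere E v a \<Longrightarrow> X u \<subseteq> nb_from E u i"
  shows "edges (nbhd G (a + i) v) =
    edges (nbhd G a v) \<union> (\<Union>u\<in>sphere E v a. last_edge ` X u)"
proof -
  have v': "v \<in> verts G" using v verts_eq by simp
  show ?thesis
  proof (intro equalityI subsetI)
    fix e assume "e \<in> edges (nbhd G (a + i) v)"
    then obtain q where q: "q \<in> nb_from E v (a + i)" "e = last_edge q"
      using edges_nbhd[OF simple v'] by auto
    show "e \<in> edges (nbhd G a v) \<union> (\<Union>u\<in>sphere E v a. last_edge ` X u)"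
    proof (cases "q \<in> nb_from E v a")
      case True
      thus ?thesis using edges_nbhd[OF simple v'] q by auto
    next
      case False
      then obtain u r where "u \<in> sphere E v a" "r \<in> outward E u i (toward E u a v)" "last_edge r = e"
        using nb_from_split q by metis
      thus ?thesis using X by blast
    qed
  next
    fix e assume "e \<in> edges (nbhd G a v) \<union> (\<Union>u\<in>sphere E v a. last_edge ` X u)"
    then consider "e \<in> edges (nbhd G a v)"
      | u q where "u \<in> sphere E v a" "q \<in> nb_from E u i" "e = last_edge q"
      using X' by blast
    thus "e \<in> edges (nbhd G (a + i) v)"
    proof cases
      case 1
      thus ?thesis using edges_nbhd[OF simple v'] by (fastforce simp: nb_from_def)
    next
      case 2
      then obtain p where p: "nb_walk E p" "hd p = v" "length p = Suc a" "last p = u" "p \<noteq> []"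
        by (force simp: sphere_def nb_exact_def)
      have q: "nb_walk E q" "hd q = u" "2 \<le> length q" "length q \<le> Suc i"
        using 2 by (auto simp: nb_from_def)
      then obtain x y r where xy: "q = u # y # r" by (cases q; cases "tl q") auto
      have adj: "{u, y} \<in> E"
        using q(1) xy unfolding nb_walk_def
        by (metis length_Cons nth_Cons_0 nth_Cons_Suc zero_less_Suc Suc_less_eq)
      have w: "is_walk G p" "is_walk G (tl q)"
        using nb_walk_is_walk[OF simple p(1)] nb_walk_is_walk[OF simple nb_walk_drop[OF q(1), of 1]]
          p v' xy simple_graph_edgeD(3)[OF simple adj] by auto
      \<comment> \<open>This walk may turn back at \<open>u\<close>; being a walk is enough for
        \<open>last_edge_nbhd\<close>.\<close>
      have "is_walk G (p @ tl q)"
        using w adj p(4) xy by (auto simp: is_walk_def successively_append_iff)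
      moreover have "hd (p @ tl q) = v" "length (p @ tl q) \<le> Suc (a + i)" "2 \<le> length (p @ tl q)"
        using p q xy a_pos by auto
      moreover have "last_edge (p @ tl q) = e"
        using 2(3) xy p by (cases r rule: rev_cases) (auto simp: last_edge_def nth_append last_conv_nth)
      ultimately show ?thesis using last_edge_nbhd[OF simple, of "p @ tl q" "a + i"] by metis
    qed
  qed
qed

end

section \<open>The algorithm\<close>

text \<open>A fixed enumeration, so that the slots of all positions refer to the same list.\<close>

definition list_of :: "'a set \<Rightarrow> 'a list" where
  "list_of S = (SOME xs. set xs = S \<and> distinct xs)"

lemma list_of:
  assumes "finite S"
  shows "set (list_of S) = S" "length (list_of S) = card S"
proof -
  have "set (list_of S) = S \<and> distinct (list_of S)"
    unfolding list_of_def by (rule someI_ex) (rule finite_distinct_list[OF assms])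
  thus "set (list_of S) = S" "length (list_of S) = card S" by (auto simp: distinct_card[symmetric])
qed

text \<open>The pair \<open>[u, u]\<close> stands for a missing edge.\<close>

definition pick :: "nat \<Rightarrow> nat list list \<Rightarrow> nat \<Rightarrow> nat list" where
  "pick u L P =
     (if L = [] then [u, u] else let p = L ! (P mod length L) in [p ! (length p - 2), p ! (length p - 1)])"

text \<open>Carries an edge from both lists, because the same slot answers every node that reserves
  \<open>P\<close> for \<open>u\<close>, whichever list that node relies on.\<close>

definition slot :: "nat set set \<Rightarrow> nat \<Rightarrow> nat \<Rightarrow> nat \<Rightarrow> nat list" where
  "slot E u i P =
     pick u (list_of (nb_from E u i)) P @ pick u (list_of (outward E u i (heavy E u i))) P"

fun pairs :: "'a list \<Rightarrow> 'a set list" where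
  "pairs (x # y # xs) = {x, y} # pairs xs"
| "pairs _ = []"

lemma pairs_append: "even (length xs) \<Longrightarrow> pairs (xs @ ys) = pairs xs @ pairs ys"
  by (induction xs rule: pairs.induct) auto

lemma pairs_concat:
  "(\<And>xs. xs \<in> set xss \<Longrightarrow> even (length xs)) \<Longrightarrow> pairs (concat xss) = concat (map pairs xss)"
  by (induction xss) (auto simp: pairs_append)

lemma set_pairs_pick:
  "set (pairs (pick u L P)) = {if L = [] then {u} else last_edge (L ! (P mod length L))}"
  by (simp add: pick_def Let_def last_edge_def)

lemma set_pairs_slot:
  "set (pairs (slot E u i P)) =
     {if L = [] then {u} else last_edge (L ! (P mod length L)) |L.
        L = list_of (nb_from E u i) \<or> L = list_of (outward E u i (heavy E u i))}"
proof -
  have "even (length (pick u L P))" for L by (simp add: pick_def Let_def)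
  thus ?thesis by (auto simp: slot_def pairs_append set_pairs_pick)
qed

definition weights :: "nat set set \<Rightarrow> nat \<Rightarrow> nat \<Rightarrow> nat \<Rightarrow> nat list" where
  "weights E u a v = map (\<lambda>i. lg (card (outward E u i (toward E u a v)))) [0..<Suc a]"

text \<open>The terms \<open>2 ^ (W u ! i) - 1\<close> underestimate the numbers of outward walks,
  so rounding never disqualifies a radius.\<close>

definition radius :: "nat \<Rightarrow> nat set set \<Rightarrow> nat \<Rightarrow> nat \<Rightarrow> (nat \<Rightarrow> nat list) \<Rightarrow> nat" where
  "radius n E v a W = Max {i. i \<le> a \<and> (\<Sum>u\<in>sphere E v a. 2 ^ (W u ! i) - 1) \<le> n}"

definition requests :: "nat set set \<Rightarrow> nat \<Rightarrow> nat \<Rightarrow> (nat \<Rightarrow> nat) \<Rightarrow> nat list" where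
  "requests E v a l = concat (map (\<lambda>u. replicate (l u) u) (sorted_list_of_set (sphere E v a)))"

text \<open>Idle positions are filled with the node's own name. The answers are then edges that the node
  knows already.\<close>

definition request :: "nat list \<Rightarrow> nat \<Rightarrow> nat \<Rightarrow> nat" where
  "request Q v P = (if P < length Q then Q ! P else v)"

definition width :: "nat \<Rightarrow> nat" where
  "width n = floorlog 2 n"

text \<open>Messages of round 1 are radii in unary, so their lengths are the numbers sent.\<close>

definition common_radius :: "nat \<Rightarrow> history \<Rightarrow> nat" where
  "common_radius n H = Min ((\<lambda>x. length ((H ! 1) x)) ` {..<n})"

text \<open>The positions \<open>0, \<dots>, 4 * n - 1\<close> are distributed over the nodes: node \<open>x\<close> is in charge of
  \<open>x + k * n\<close> for \<open>k < 4\<close>. In round 2 node \<open>u\<close> tells \<open>v\<close> how many consecutive positions \<open>v\<close> has to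
  reserve for \<open>u\<close>, and hands over the slots of the positions of \<open>v\<close>; in round 3 node \<open>u\<close> asks \<open>v\<close> for
  the slots of the nodes for which \<open>u\<close> has reserved the positions of \<open>v\<close>.\<close>

definition message :: "(nat \<times> nat set set) cc_input \<Rightarrow> history \<Rightarrow> nat \<Rightarrow> bool list" where
  "message inp H v =
     (let n = num_nodes inp; u = ident inp; a = fst (prior inp); E = snd (prior inp);
          w = width n; i = common_radius n H
      in if length H = 0 then stair 0 (weights E u a v)
         else if length H = 1 then replicate (radius n E u a (\<lambda>x. unstair 0 ((H ! 0) x))) True
         else if length H = 2 then
           encode w (card (stock E u i (toward E u a v)) #
             concat (map (\<lambda>k. slot E u i (v + k * n)) [0..<4]))
         else if length H = 3 then
           encode w (map 
             (\<lambda>k. request (requests E u a (\<lambda>x. hd (decode w ((H ! 2) x)))) u (v + k * n)) [0..<4])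
         else
           encode w (concat (map
             (\<lambda>k. take 4 (drop (k * 4) (tl (decode w ((H ! 2) (decode w ((H ! 3) v) ! k))))))
             [0..<4])))"

text \<open>The condition \<open>card e = 2\<close> discards the placeholders for missing
  edges.\<close>

definition answer :: "(nat \<times> nat set set) cc_input \<Rightarrow> history \<Rightarrow> outcome" where
  "answer inp H =
     (let n = num_nodes inp; v = ident inp; a = fst (prior inp); E = snd (prior inp);
          w = width n; i = common_radius n H;
          E' = E \<union> {e. card e = 2 \<and> (\<exists>x<n. e \<in> set (pairs (decode w ((H ! 4) x))))};
          N = \<lparr>verts = insert v (\<Union> E'), edges = E'\<rparr>
      in if i = a then Doubled N else Radius_Reached (a + i) N)"

text \<open>A block of \<open>l u\<close> consecutive positions meets every residue modulo
  \<open>l u\<close>, wherever it starts.\<close>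

lemma nth_requests:
  assumes "finite (sphere E v a)" "u \<in> sphere E v a" "j < l u"
  obtains P where "P < length (requests E v a l)" "P mod l u = j" "requests E v a l ! P = u"
proof -
  have "u \<in> set (sorted_list_of_set (sphere E v a))" using assms by simp
  then obtain xs ys where xy: "sorted_list_of_set (sphere E v a) = xs @ u # ys"
    by (meson split_list)
  define pre where "pre = concat (map (\<lambda>u. replicate (l u) u) xs)"
  define post where "post = concat (map (\<lambda>u. replicate (l u) u) ys)"
  have Q: "requests E v a l = pre @ replicate (l u) u @ post"
    by (simp add: requests_def xy pre_def post_def)
  define m where "m = length pre"
  \<comment> \<open>The offset is \<open>j - m\<close> modulo \<open>l u\<close>; adding
    \<open>l u\<close> first keeps the subtraction on naturals exact.\<close>
  define s where "s = (j + l u - m mod l u) mod l u"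
  have s: "s < l u" using assms(3) by (simp add: s_def)
  have "(m + s) mod l u = (m mod l u + (j + l u - m mod l u)) mod l u"
    unfolding s_def by (metis mod_add_left_eq mod_add_right_eq)
  also have "m mod l u + (j + l u - m mod l u) = j + l u"
    using assms(3) by (simp add: less_imp_le_nat trans_le_add2)
  also have "(j + l u) mod l u = j" using assms(3) by simp
  finally have "(m + s) mod l u = j" .
  moreover have "m + s < length (requests E v a l)" using s by (simp add: Q m_def)
  moreover have "requests E v a l ! (m + s) = u" using s by (simp add: Q m_def nth_append)
  ultimately show thesis using that by blast
qed

lemma length_requests:
  assumes "finite (sphere E v a)"
  shows "length (requests E v a l) = (\<Sum>u\<in>sphere E v a. l u)"
proof -
  have "length (requests E v a l) = sum_list (map l (sorted_list_of_set (sphere E v a)))"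
    by (simp add: requests_def length_concat comp_def)
  also have "\<dots> = (\<Sum>u\<in>sphere E v a. l u)"
    using assms by (subst sum_list_distinct_conv_sum_set) auto
  finally show ?thesis .
qed

section \<open>Correctness\<close>

context girth_instance begin

section \<open>Local computations agree with the whole graph\<close>

abbreviation (input) K :: "nat \<Rightarrow> nat set set" where "K v \<equiv> edges (nbhd G a v)"

lemma v_verts: "v < n \<Longrightarrow> v \<in> verts G" using verts_eq by simp

lemma local_eqs:
  assumes u: "u < n"
  shows "toward (K u) u a v = toward E u a v"
    and "i \<le> a \<Longrightarrow> stock (K u) u i z = stock E u i z"
    and "i \<le> a \<Longrightarrow> slot (K u) u i P = slot E u i P"
    and "weights (K u) u a v = weights E u a v"
    and "radius n (K u) u a W = radius n E u a W"
    and "requests (K u) u a l = requests E u a l"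
proof -
  note nb = nb_from_nbhd[OF simple v_verts[OF u], of _ a]
  note ex = nb_exact_nbhd[OF simple v_verts[OF u], of a]
  have sphere: "sphere (K u) u a = sphere E u a"
    by (simp add: sphere_def ex)
  show toward: "toward (K u) u a v = toward E u a v" for v
    by (simp add: toward_def ex)
  have walks: "outward (K u) u i z = outward E u i z" "heavy (K u) u i = heavy E u i" if "i \<le> a" for i z
    using that by (simp_all add: outward_def heavy_def branch_def nb)
  show "i \<le> a \<Longrightarrow> stock (K u) u i z = stock E u i z" by (simp add: stock_def nb walks)
  show "i \<le> a \<Longrightarrow> slot (K u) u i P = slot E u i P" by (simp add: slot_def nb walks)
  show "weights (K u) u a v = weights E u a v" by (auto simp: weights_def toward walks)
  show "radius n (K u) u a W = radius n E u a W" by (simp add: radius_def sphere)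
  show "requests (K u) u a l = requests E u a l" by (simp add: requests_def sphere)
qed

section \<open>The agreed radius\<close>

definition out_card :: "nat \<Rightarrow> nat \<Rightarrow> nat \<Rightarrow> nat" where
  "out_card u v i = card (outward E u i (toward E u a v))"

lemma out_card_mono:
  assumes "u < n" "i \<le> j" "j \<le> a" shows "out_card u v i \<le> out_card u v j"
proof -
  have "finite (nb_from E u j)" using card_nb_from(1)[of j u] two_a_less assms by simp
  thus ?thesis unfolding out_card_def
    by (intro card_mono outward_mono assms) (auto simp: outward_def)
qed

lemma out_card_le:
  assumes "u < n" "i \<le> a" shows "out_card u v i \<le> n"
proof -
  have "finite (nb_from E u i)" "card (nb_from E u i) \<le> n"
    using card_nb_from[of i u] two_a_less assms by simp_all
  moreover from this(1) have "out_card u v i \<le> card (nb_from E u i)"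
    unfolding out_card_def by (intro card_mono) (auto simp: outward_def)
  ultimately show ?thesis by simp
qed

lemma weights_nth: "i \<le> a \<Longrightarrow> weights E u a v ! i = lg (out_card u v i)"
  by (simp add: weights_def out_card_def del: upt_Suc)

lemma sorted_weights: assumes "u < n" shows "sorted (0 # weights E u a v)"
proof -
  have "sorted (weights E u a v)"
    unfolding sorted_iff_nth_mono
  proof (intro allI impI)
    fix i j assume ij: "i \<le> j" "j < length (weights E u a v)"
    hence "j \<le> a" by (simp add: weights_def)
    thus "weights E u a v ! i \<le> weights E u a v ! j"
      using ij(1) out_card_mono[OF assms ij(1)] by (simp add: weights_nth lg_mono)
  qed
  thus ?thesis by simp
qed

definition local_radius :: "nat \<Rightarrow> nat" where
  "local_radius v = Max {i. i \<le> a \<and> (\<Sum>u\<in>sphere E v a. 2 ^ lg (out_card u v i) - 1) \<le> n}"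

definition final_radius :: nat where
  "final_radius = Min (local_radius ` {..<n})"

lemma local_radius:
  shows "local_radius v \<le> a"
    and "(\<Sum>u\<in>sphere E v a. 2 ^ lg (out_card u v (local_radius v)) - 1) \<le> n"
    and "\<lbrakk>i \<le> a; (\<Sum>u\<in>sphere E v a. 2 ^ lg (out_card u v i) - 1) \<le> n\<rbrakk> \<Longrightarrow> i \<le> local_radius v"
proof -
  let ?S = "{i. i \<le> a \<and> (\<Sum>u\<in>sphere E v a. 2 ^ lg (out_card u v i) - 1) \<le> n}"
  \<comment> \<open>Radius 0 always qualifies, so \<open>Max\<close> is taken over a nonempty
    set.\<close>
  have "outward E u 0 z = {}" for u z by (auto simp: outward_def nb_from_def)
  hence "out_card u v 0 = 0" for u by (simp add: out_card_def)
  moreover have "lg 0 = 0" by (simp add: lg_def floorlog_def)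
  ultimately have "0 \<in> ?S" by simp
  moreover have fin: "finite ?S" by simp
  ultimately have "local_radius v \<in> ?S"
    unfolding local_radius_def using Max_in by blast
  thus "local_radius v \<le> a"
    and "(\<Sum>u\<in>sphere E v a. 2 ^ lg (out_card u v (local_radius v)) - 1) \<le> n" by auto
  show "i \<le> local_radius v" if "i \<le> a" "(\<Sum>u\<in>sphere E v a. 2 ^ lg (out_card u v i) - 1) \<le> n"
    unfolding local_radius_def using that fin by (intro Max_ge) auto
qed

lemma final_radius_le: "v < n \<Longrightarrow> final_radius \<le> local_radius v"
  unfolding final_radius_def by (rule Min_le) auto

lemma final_radius_le_a: "final_radius \<le> a"
  using final_radius_le[of 0] local_radius(1)[of 0] n_ge by simp

text \<open>Below half the girth \<open>sum_outward_le\<close> bounds the true numbers, hence also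
  their underestimates, at every node.\<close>

lemma final_radius_large:
  assumes "i \<le> a" "2 * (a + i) < g"
  shows "i \<le> final_radius"
proof -
  have "i \<le> local_radius v" if v: "v < n" for v
  proof (rule local_radius(3)[OF assms(1)])
    have "2 ^ lg m - 1 \<le> m" for m using lg_bounds(1)[of m] by simp
    hence "(\<Sum>u\<in>sphere E v a. 2 ^ lg (out_card u v i) - 1) \<le> (\<Sum>u\<in>sphere E v a. out_card u v i)"
      by (intro sum_mono)
    also have "\<dots> \<le> n" unfolding out_card_def by (rule sum_outward_le[OF assms(2) v])
    finally show "(\<Sum>u\<in>sphere E v a. 2 ^ lg (out_card u v i) - 1) \<le> n" .
  qed
  moreover have "{..<n} \<noteq> {}" using n_ge by (simp add: lessThan_empty_iff)
  ultimately show ?thesis unfolding final_radius_def by (subst Min_ge_iff) auto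
qed

section \<open>Loads and slots\<close>

definition load :: "nat \<Rightarrow> nat \<Rightarrow> nat" where
  "load u v = card (stock E u final_radius (toward E u a v))"

lemma finite_walks: "u < n \<Longrightarrow> i \<le> a \<Longrightarrow> finite (nb_from E u i)"
  using card_nb_from(1)[of i u] two_a_less by simp

lemma load_le: "u < n \<Longrightarrow> load u v \<le> n"
proof -
  assume u: "u < n"
  have "load u v \<le> card (nb_from E u final_radius)"
    unfolding load_def by (rule card_mono[OF finite_walks[OF u final_radius_le_a] stock_subset])
  also have "\<dots> \<le> n" using card_nb_from(2)[of final_radius u] u two_a_less final_radius_le_a by simp
  finally show ?thesis .
qed

text \<open>One factor of two comes from \<open>card_stock_le\<close>, the other from rounding by
  \<open>lg\<close>. The bound by \<open>n\<close> is known at the radius of \<open>v\<close>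
  itself, and monotonicity carries it to the smaller common radius.\<close>

lemma sum_load_le:
  assumes v: "v < n" shows "(\<Sum>u\<in>sphere E v a. load u v) \<le> 4 * n"
proof -
  have "load u v \<le> 4 * (2 ^ lg (out_card u v (local_radius v)) - 1)" if u: "u \<in> sphere E v a" for u
  proof -
    have un: "u < n" using sphere_less[OF v u] .
    have "load u v \<le> 2 * out_card u v final_radius"
      unfolding load_def out_card_def by (rule card_stock_le[OF finite_walks[OF un final_radius_le_a]])
    also have "out_card u v final_radius \<le> out_card u v (local_radius v)"
      by (rule out_card_mono[OF un final_radius_le[OF v] local_radius(1)])
    also have "out_card u v (local_radius v) \<le> 2 * (2 ^ lg (out_card u v (local_radius v)) - 1)"
      using lg_bounds(2)[of "out_card u v (local_radius v)"] by simp
    finally show ?thesis by simp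
  qed
  hence "(\<Sum>u\<in>sphere E v a. load u v) \<le> (\<Sum>u\<in>sphere E v a. 4 * (2 ^ lg (out_card u v (local_radius v)) - 1))"
    by (rule sum_mono)
  also have "\<dots> \<le> 4 * n" using local_radius(2)[of v] by (simp flip: sum_distrib_left)
  finally show ?thesis .
qed

lemma length_slot [simp]: "length (slot E u i P) = 4"
  by (simp add: slot_def pick_def Let_def)

lemma set_pick:
  assumes "u < n" "i \<le> a" "set L \<subseteq> nb_from E u i"
  shows "set (pick u L P) \<subseteq> {..<n}"
proof (cases "L = []")
  case False
  define p where "p = L ! (P mod length L)"
  have "p \<in> set L" using False by (simp add: p_def)
  hence "p \<in> nb_from E u i" using assms(3) by blast
  hence "is_walk G p" "2 \<le> length p"
    using nb_walk_is_walk[OF simple, of p] assms verts_eq by (auto simp: nb_from_def)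
  hence "set p \<subseteq> {..<n}" "p ! (length p - 2) \<in> set p" "p ! (length p - 1) \<in> set p"
    using verts_eq by (auto simp: is_walk_def)
  thus ?thesis using False by (auto simp: pick_def Let_def p_def[symmetric])
qed (use assms in \<open>simp add: pick_def\<close>)

lemma set_list_of:
  assumes "u < n" "i \<le> a"
  shows "set (list_of (nb_from E u i)) = nb_from E u i"
    and "set (list_of (outward E u i z)) = outward E u i z"
proof -
  show "set (list_of (nb_from E u i)) = nb_from E u i"
    by (rule list_of(1)[OF finite_walks[OF assms]])
  have "finite (outward E u i z)" using finite_walks[OF assms] by (simp add: outward_def)
  thus "set (list_of (outward E u i z)) = outward E u i z" by (rule list_of(1))
qed

lemma set_slot:
  assumes "u < n" "i \<le> a" shows "set (slot E u i P) \<subseteq> {..<n}"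
proof -
  have "outward E u i z \<subseteq> nb_from E u i" for z by (auto simp: outward_def)
  thus ?thesis
    using set_pick[OF assms] set_list_of[OF assms] by (simp add: slot_def)
qed

section \<open>The messages round by round\<close>

abbreviation (input) I :: "nat \<Rightarrow> (nat \<times> nat set set) cc_input" where
  "I \<equiv> cc_initial G (nbhd_knowledge G a)"

abbreviation (input) H :: "nat \<Rightarrow> nat \<Rightarrow> history" where "H \<equiv> run message n I"

lemma I_simps: "num_nodes (I u) = n" "ident (I u) = u" "prior (I u) = (a, K u)"
  using verts_eq by (simp_all add: cc_initial_def nbhd_knowledge_def)

lemma H_nth: "\<lbrakk>j < r; u < n\<rbrakk> \<Longrightarrow> (H r v ! j) u = message (I u) (H j u) v"
  by (simp add: run_nth)

lemma less_width: "x \<le> n \<Longrightarrow> x < 2 ^ width n" and width_pos: "0 < width n"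
proof -
  have "n < 2 ^ width n" using floorlog_bounds[of n 2] n_ge by (simp add: width_def)
  thus "x \<le> n \<Longrightarrow> x < 2 ^ width n" by simp
  show "0 < width n" using n_ge by (simp add: width_def floorlog_def)
qed

lemma message_0:
  assumes "u < n"
  shows "message (I u) (H 0 u) v = stair 0 (weights E u a v)"
  by (subst message_def) (simp add: Let_def I_simps local_eqs(4)[OF assms])

lemma message_1:
  assumes u: "u < n"
  shows "message (I u) (H 1 u) v = replicate (local_radius u) True"
proof -
  have W: "unstair 0 ((H 1 u ! 0) x) = weights E x a u" if "x \<in> sphere E u a" for x
    using H_nth[of 0 1 x u] message_0 unstair_stair sorted_weights sphere_less[OF u that]
    by simp
  have "(i \<le> a \<and> (\<Sum>x\<in>sphere E u a. 2 ^ (unstair 0 ((H 1 u ! 0) x) ! i) - 1) \<le> n) \<longleftrightarrow>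
    (i \<le> a \<and> (\<Sum>x\<in>sphere E u a. 2 ^ lg (out_card x u i) - 1) \<le> n)" for i
    using W by (simp add: weights_nth cong: conj_cong)
  hence "radius n E u a (\<lambda>x. unstair 0 ((H 1 u ! 0) x)) = local_radius u"
    unfolding radius_def local_radius_def by simp
  thus ?thesis
    by (subst message_def) (simp add: Let_def I_simps local_eqs(5)[OF u])
qed

lemma common_radius: "2 \<le> r \<Longrightarrow> common_radius n (H r v) = final_radius"
  unfolding common_radius_def final_radius_def
  by (rule arg_cong[where f = Min], rule image_cong) (simp_all add: H_nth message_1 del: One_nat_def)

lemma message_2:
  assumes u: "u < n"
  shows "message (I u) (H 2 u) v = encode (width n)
    (load u v # concat (map (\<lambda>k. slot E u final_radius (v + k * n)) [0..<4]))"
  by (subst message_def)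
    (simp add: Let_def I_simps common_radius local_eqs(1,2,3)[OF u] final_radius_le_a load_def)

lemma decode_message_2:
  assumes u: "u < n"
  shows "decode (width n) (message (I u) (H 2 u) v) =
    load u v # concat (map (\<lambda>k. slot E u final_radius (v + k * n)) [0..<4])"
  unfolding message_2[OF u]
proof (rule decode_encode[OF width_pos])
  fix x assume "x \<in> set (load u v # concat (map (\<lambda>k. slot E u final_radius (v + k * n)) [0..<4]))"
  hence "x \<le> n" using load_le[OF u] set_slot[OF u final_radius_le_a] by fastforce
  thus "x < 2 ^ width n" by (rule less_width)
qed

definition plan :: "nat \<Rightarrow> nat list" where
  "plan v = requests E v a (\<lambda>u. load u v)"

lemma request_less:
  assumes v: "v < n" shows "request (plan v) v P < n"
proof -
  have "set (plan v) \<subseteq> sphere E v a"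
    using finite_sphere[OF v] by (auto simp: plan_def requests_def)
  thus ?thesis using v sphere_less[OF v] by (auto simp: request_def subset_iff)
qed

lemma message_3:
  assumes v: "v < n"
  shows "message (I v) (H 3 v) r = encode (width n) (map (\<lambda>k. request (plan v) v (r + k * n)) [0..<4])"
proof -
  have "hd (decode (width n) ((H 3 v ! 2) x)) = load x v" if "x \<in> sphere E v a" for x
    using decode_message_2[OF sphere_less[OF v that]] H_nth[of 2 3 x v] sphere_less[OF v that] by simp
  hence "requests E v a (\<lambda>x. hd (decode (width n) ((H 3 v ! 2) x))) = plan v"
    unfolding plan_def requests_def using finite_sphere[OF v]
    by (intro arg_cong[where f = concat] map_cong) auto
  thus ?thesis
    by (subst message_def) (simp add: Let_def I_simps local_eqs(6)[OF v])
qed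

lemma decode_message_3:
  assumes v: "v < n"
  shows "decode (width n) (message (I v) (H 3 v) r) = map (\<lambda>k. request (plan v) v (r + k * n)) [0..<4]"
  unfolding message_3[OF v]
  by (rule decode_encode[OF width_pos]) (auto intro!: less_width less_imp_le request_less v)

lemma message_4:
  assumes r: "r < n" and v: "v < n"
  shows "message (I r) (H 4 r) v = encode (width n)
    (concat (map (\<lambda>k. slot E (request (plan v) v (r + k * n)) final_radius (r + k * n)) [0..<4]))"
proof -
  have "take 4 (drop (k * 4) (tl (decode (width n) ((H 4 r ! 2) (decode (width n) ((H 4 r ! 3) v) ! k))))) =
    slot E (request (plan v) v (r + k * n)) final_radius (r + k * n)" if k: "k \<in> set [0..<4]" for k
  proof -
    let ?u = "request (plan v) v (r + k * n)"
    have "decode (width n) ((H 4 r ! 3) v) ! k = ?u"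
      using H_nth[of 3 4 v r] v decode_message_3[OF v] k by simp
    moreover have "tl (decode (width n) ((H 4 r ! 2) ?u)) =
      concat (map (\<lambda>k. slot E ?u final_radius (r + k * n)) [0..<4])"
      using H_nth[of 2 4 ?u r] decode_message_2 request_less[OF v] by simp
    ultimately show ?thesis
      using k take_drop_concat_uniform[of "[0..<4]" "\<lambda>k. slot E ?u final_radius (r + k * n)" 4 k] by simp
  qed
  hence eq: "map (\<lambda>k. take 4 (drop (k * 4) (tl (decode (width n) ((H 4 r ! 2) (decode (width n) ((H 4 r ! 3) v) ! k))))))
      [0..<4] =
    map (\<lambda>k. slot E (request (plan v) v (r + k * n)) final_radius (r + k * n)) [0..<4]"
    by (rule map_cong[OF refl])
  show ?thesis
    by (subst message_def) (simp add: Let_def I_simps eq)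
qed

lemma decode_message_4:
  assumes r: "r < n" and v: "v < n"
  shows "decode (width n) (message (I r) (H 4 r) v) =
    concat (map (\<lambda>k. slot E (request (plan v) v (r + k * n)) final_radius (r + k * n)) [0..<4])"
  unfolding message_4[OF r v]
proof (rule decode_encode[OF width_pos])
  fix x assume "x \<in> set (concat (map (\<lambda>k. slot E (request (plan v) v (r + k * n)) final_radius (r + k * n)) [0..<4]))"
  hence "x \<le> n" using set_slot[OF request_less[OF v] final_radius_le_a] by fastforce
  thus "x < 2 ^ width n" by (rule less_width)
qed

lemma received_edges:
  assumes v: "v < n"
  shows "K v \<union> {e. card e = 2 \<and> (\<exists>x<n. e \<in> set (pairs (decode (width n) ((H 5 v ! 4) x))))} =
    edges (nbhd G (a + final_radius) v)" (is "K v \<union> ?C = ?R")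
proof -
  let ?i = final_radius
  have C: "e \<in> ?C \<longleftrightarrow> card e = 2 \<and>
    (\<exists>x<n. \<exists>k<4. e \<in> set (pairs (slot E (request (plan v) v (x + k * n)) ?i (x + k * n))))" for e
  proof -
    have dec: "set (pairs (decode (width n) ((H 5 v ! 4) x))) =
      (\<Union>k<4. set (pairs (slot E (request (plan v) v (x + k * n)) ?i (x + k * n))))" if x: "x < n" for x
    proof -
      let ?S = "map (\<lambda>k. slot E (request (plan v) v (x + k * n)) ?i (x + k * n)) [0..<4]"
      have "decode (width n) ((H 5 v ! 4) x) = concat ?S"
        using x v by (simp add: H_nth decode_message_4)
      moreover have "pairs (concat ?S) = concat (map pairs ?S)"
        by (rule pairs_concat) auto
      ultimately show ?thesis by auto
    qed
    show ?thesis by (simp add: dec Bex_def cong: conj_cong)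
  qed
  note add = edges_nbhd_add[OF v, where i = ?i]
  have R1: "?R = K v \<union> (\<Union>u\<in>sphere E v a. last_edge ` stock E u ?i (toward E u a v))"
    by (rule add[OF outward_subset_stock stock_subset])
  have R2: "?R = K v \<union> (\<Union>u\<in>sphere E v a. last_edge ` nb_from E u ?i)"
    by (rule add) (auto simp: outward_def)
  have "?C \<subseteq> ?R"
  proof
    fix e assume "e \<in> ?C"
    then obtain P where e: "card e = 2" "e \<in> set (pairs (slot E (request (plan v) v P) ?i P))"
      using C by blast
    define u where "u = request (plan v) v P"
    have u: "u < n" unfolding u_def by (rule request_less[OF v])
    obtain L where L: "L = list_of (nb_from E u ?i) \<or> L = list_of (outward E u ?i (heavy E u ?i))"
      "e = (if L = [] then {u} else last_edge (L ! (P mod length L)))"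
      using e(2) unfolding u_def[symmetric] set_pairs_slot by blast
    have "L \<noteq> []" using L(2) e(1) by auto
    hence "L ! (P mod length L) \<in> set L" by simp
    moreover have "set L \<subseteq> nb_from E u ?i"
      using L(1) set_list_of[OF u final_radius_le_a] by (auto simp: outward_def)
    moreover have "e = last_edge (L ! (P mod length L))" using L(2) \<open>L \<noteq> []\<close> by simp
    ultimately have e': "e \<in> last_edge ` nb_from E u ?i" by blast
    have "u = v \<or> u \<in> sphere E v a"
      using finite_sphere[OF v] nth_mem[of P "plan v"]
      by (auto simp: u_def request_def plan_def requests_def)
    thus "e \<in> ?R"
    proof
      assume "u = v"
      thus ?thesis using e' edges_nbhd[OF simple v_verts[OF v]] by (auto simp: nb_from_def)
    next
      assume "u \<in> sphere E v a"
      thus ?thesis using e' unfolding R2 by blast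
    qed
  qed
  moreover have "?R \<subseteq> K v \<union> ?C"
  proof
    fix e assume eR: "e \<in> ?R"
    show "e \<in> K v \<union> ?C"
    proof (cases "e \<in> K v")
      case False
      then obtain u q where u: "u \<in> sphere E v a" and q: "q \<in> stock E u ?i (toward E u a v)" "e = last_edge q"
        using eR unfolding R1 by blast
      have un: "u < n" by (rule sphere_less[OF v u])
      define L where "L = list_of (stock E u ?i (toward E u a v))"
      have fin: "finite (stock E u ?i (toward E u a v))"
        using finite_subset[OF stock_subset finite_walks[OF un final_radius_le_a]] .
      have L: "set L = stock E u ?i (toward E u a v)" "length L = load u v"
        using list_of[OF fin] by (simp_all add: L_def load_def)
      then obtain j where j: "j < load u v" "L ! j = q" using q(1) by (metis in_set_conv_nth)
      obtain P where P: "P < length (plan v)" "P mod load u v = j" "plan v ! P = u"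
        using nth_requests[OF finite_sphere[OF v] u, of j "\<lambda>u. load u v"] j(1)
        unfolding plan_def by blast
      have "length (plan v) \<le> 4 * n"
        unfolding plan_def length_requests[OF finite_sphere[OF v]] by (rule sum_load_le[OF v])
      hence "P div n < 4" using P(1) n_ge by (simp add: less_mult_imp_div_less)
      moreover have "P mod n < n" "P mod n + P div n * n = P" using n_ge by auto
      moreover have "e \<in> set (pairs (slot E (request (plan v) v P) ?i P))"
      proof -
        have req: "request (plan v) v P = u" using P by (simp add: request_def)
        have "L = list_of (nb_from E u ?i) \<or> L = list_of (outward E u ?i (heavy E u ?i))"
          by (auto simp: L_def stock_def)
        moreover have "e = (if L = [] then {u} else last_edge (L ! (P mod length L)))"
          using P(2) L(2) j q(2) by auto
        ultimately show ?thesis unfolding req set_pairs_slot by blast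
      qed
      moreover have "card e = 2" using eR simple by (auto simp: nbhd_def simple_graph_def)
      ultimately have "e \<in> ?C" unfolding C by metis
      thus ?thesis by simp
    qed simp
  qed
  moreover have "K v \<subseteq> ?R" unfolding R1 by blast
  ultimately show ?thesis by blast
qed

lemma answer_eq:
  assumes v: "v < n"
  shows "answer (I v) (H 5 v) =
    (if final_radius = a then Doubled (nbhd G (2 * a) v)
     else Radius_Reached (a + final_radius) (nbhd G (a + final_radius) v))"
proof -
  have "\<lparr>verts = insert v (\<Union> (edges (nbhd G (a + final_radius) v))),
      edges = edges (nbhd G (a + final_radius) v)\<rparr> = nbhd G (a + final_radius) v"
    by (rule nbhd_eqI[OF simple v_verts[OF v]]) simp
  thus ?thesis
    unfolding answer_def Let_def I_simps
    using received_edges[OF v] common_radius[of 5 v]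
    by (cases "final_radius = a") (simp_all add: mult_2)
qed

lemma lg_le_log:
  assumes "m \<le> n" shows "real (lg m) \<le> log 2 (real n) + 1"
proof -
  have "2 ^ lg m \<le> 2 * n" using lg_bounds(1)[of m] assms n_ge by linarith
  hence "real (2 ^ lg m) \<le> real (2 * n)" by (simp only: of_nat_le_iff)
  hence "2 powr real (lg m) \<le> 2 * real n" by (simp add: powr_realpow)
  hence "real (lg m) \<le> log 2 (2 * real n)" using n_ge by (simp add: le_log_iff)
  thus ?thesis using n_ge by (simp add: log_mult)
qed

lemma width_le: "real (width n) \<le> log 2 (real n) + 1"
  using n_ge log_ge by (simp add: width_def floorlog_def)

lemma message_length:
  assumes u: "u < n" and r: "r < 5" and v: "v < n"
  shows "real (length (message (I u) (H r u) v)) \<le> 40 * log 2 (real n)"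
proof -
  consider "r = 0" | "r = 1" | "r = 2" | "r = 3" | "r = 4" using r by linarith
  thus ?thesis
  proof cases
    case 1
    have "length (weights E u a v) = Suc a" by (simp add: weights_def)
    moreover from this have "last (0 # weights E u a v) = lg (out_card u v a)"
      using weights_nth[of a u v] by (cases "weights E u a v = []") (auto simp: last_conv_nth)
    ultimately have "length (message (I u) (H r u) v) = Suc a + lg (out_card u v a)"
      using length_stair[OF sorted_weights[OF u, of v]] message_0[OF u] 1 by simp
    moreover have "real (lg (out_card u v a)) \<le> log 2 (real n) + 1"
      by (rule lg_le_log[OF out_card_le[OF u order_refl]])
    ultimately show ?thesis using a_less_log log_ge by simp
  next
    case 2
    have "real (local_radius u) \<le> real a" using local_radius(1)[of u] by simp
    thus ?thesis using message_1[OF u, of v] a_less_log log_ge 2 by simp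
  next
    case 3
    have "length (message (I u) (H r u) v) = 17 * width n"
      unfolding 3 message_2[OF u] length_encode by (simp add: length_concat comp_def upt_rec)
    thus ?thesis using width_le log_ge by simp
  next
    case 4
    have "length (message (I u) (H r u) v) = 4 * width n"
      unfolding 4 message_3[OF u] length_encode by simp
    thus ?thesis using width_le log_ge by simp
  next
    case 5
    have "length (message (I u) (H r u) v) = 16 * width n"
      unfolding 5 message_4[OF u v] length_encode by (simp add: length_concat comp_def upt_rec)
    thus ?thesis using width_le log_ge by simp
  qed
qed

lemma protocol_correct:
  fixes out defines "out \<equiv> cc_output (protocol message answer) n I 5"
  shows "cc_bandwidth (protocol message answer) n I 5 (40 * log 2 (real n))"
    and "(\<forall>v\<in>verts G. out v = Doubled (nbhd G (2 * a) v)) \<or>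
      (\<exists>b :: nat. int b \<ge> \<lceil>real g / 2\<rceil> - 1 \<and> (\<forall>v\<in>verts G. out v = Radius_Reached b (nbhd G b v)))"
proof -
  show "cc_bandwidth (protocol message answer) n I 5 (40 * log 2 (real n))"
    by (rule cc_bandwidth_protocol) (auto simp: I_simps message_length)
  have out: "out v = answer (I v) (H 5 v)" if "v < n" for v
    unfolding out_def by (rule cc_output_protocol) (auto simp: I_simps that)
  show "(\<forall>v\<in>verts G. out v = Doubled (nbhd G (2 * a) v)) \<or>
      (\<exists>b :: nat. int b \<ge> \<lceil>real g / 2\<rceil> - 1 \<and> (\<forall>v\<in>verts G. out v = Radius_Reached b (nbhd G b v)))"
  proof (cases "final_radius = a")
    case True
    thus ?thesis using out answer_eq verts_eq by simp
  next
    case False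
    let ?b = "(g - 1) div 2"
    have "a \<le> ?b" using two_a_less by simp
    have "\<not> 2 * (a + a) < g"
      using final_radius_large[of a] final_radius_le_a False by auto
    hence "?b - a \<le> a" by presburger
    hence "?b - a \<le> final_radius"
      using two_a_less \<open>a \<le> ?b\<close> by (intro final_radius_large) auto
    hence "g \<le> 2 * (a + final_radius) + 2" using \<open>a \<le> ?b\<close> by simp
    hence "real g / 2 \<le> real_of_int (int (a + final_radius) + 1)" by simp
    hence "\<lceil>real g / 2\<rceil> \<le> int (a + final_radius) + 1" by (simp only: ceiling_le_iff)
    thus ?thesis using False out answer_eq verts_eq by (intro disjI2 exI[of _ "a + final_radius"]) simp
  qed
qed

end

theorem theorem12:
  shows "\<exists>(A :: (nat \<times> nat set set, outcome) cc_algorithm) (R :: nat) (c :: real).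
    \<forall>(n :: nat) (G :: nat ugraph) (g :: nat) (a :: nat).
      simple_graph G \<and> verts G = {..<n} \<and>
      girth G = enat g \<and> real g < log 2 (real n) \<and>
      (\<forall>v\<in>verts G. 2 \<le> degree G v) \<and>
      0 < a \<and> (\<forall>v\<in>verts G. is_tree (nbhd G a v)) \<longrightarrow>
      (let I = cc_initial G (nbhd_knowledge G a);
           out = cc_output A n I R
       in cc_bandwidth A n I R (c * log 2 (real n)) \<and>
          ((\<forall>v\<in>verts G. out v = Girth_Reported g) \<or>
           (\<forall>v\<in>verts G. out v = Doubled (nbhd G (2 * a) v)) \<or>
           (\<exists>b :: nat. int b \<ge> \<lceil>real g / 2\<rceil> - 1 \<and>
              (\<forall>v\<in>verts G. out v = Radius_Reached b (nbhd G b v)))))"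
proof (intro exI allI impI)
  fix n G g a
  assume "simple_graph G \<and> verts G = {..<n} \<and>
      girth G = enat g \<and> real g < log 2 (real n) \<and>
      (\<forall>v\<in>verts G. 2 \<le> degree G v) \<and>
      0 < a \<and> (\<forall>v\<in>verts G. is_tree (nbhd G a v))"
  then interpret girth_instance n G g a by unfold_locales auto
  show "let I = cc_initial G (nbhd_knowledge G a);
           out = cc_output (protocol message answer) n I 5
       in cc_bandwidth (protocol message answer) n I 5 (40 * log 2 (real n)) \<and>
          ((\<forall>v\<in>verts G. out v = Girth_Reported g) \<or>
           (\<forall>v\<in>verts G. out v = Doubled (nbhd G (2 * a) v)) \<or>
           (\<exists>b :: nat. int b \<ge> \<lceil>real g / 2\<rceil> - 1 \<and>
              (\<forall>v\<in>verts G. out v = Radius_Reached b (nbhd G b v))))"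
    unfolding Let_def using protocol_correct by blast
qed

end
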